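(* Let $d \ge 1$. Let $Q$ be a symmetric, translation-invariant, heavy-tailed transition kernel on $\mathbb{Z}^d$ with exponent $\alpha \in (0, d)$, and let $\Delta>0$ be defined by $\Delta^{-1} = \log_2\big(2d/(d+\alpha)\big)$. Consider the frog model on $\mathbb{Z}^d$ with kernel $Q$ (without planted particle), with any fixed particle lifespan $\ell \in \{1,2,\dots\}$ and particle density $\lambda > 0$. Then there exists a constant $c = c(Q, \lambda, \ell)>0$ such that $\mathbb{P}$-almost surely $\mathcal{A}(c(\log L)^\Delta) \subseteq B(L)$ for all sufficiently large $L$, and $$\lim_{L \to \infty} \frac{|\mathcal{A}(c(\log L)^\Delta)|}{L^d} = 0,$$ where $B(L) = [-L, L]^d \cap \mathbb{Z}^d$ and $\mathcal{A}(t)$ is the set of vertices activated by time $t$.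
   Context: **Kernels.** $|\cdot|$ is the $\ell_\infty$-norm. A transition kernel $Q$ on $\mathbb{Z}^d$ (nonnegative, rows summing to 1) is symmetric if $Q(x,y)=Q(y,x)$, translation-invariant if $Q(x,y)=Q(0,y-x)$, and heavy-tailed with exponent $\alpha$ if there is $K>0$ with $K^{-1}|x-y|^{-(d+\alpha)}\le Q(x,y)\le K|x-y|^{-(d+\alpha)}$ for all $x\neq y$. $o=0$ is the origin. **Frog model.** Each vertex $v\in\mathbb{Z}^d$ carries an independent Poisson($\lambda$) number of particles. Every particle has an independent infinite discrete-time random walk trajectory with kernel $Q$ started at its initial vertex. At time 0 the particles at $o$ are active and all others are inactive; an active particle walks along its trajectory for $\ell$ steps and is then removed, and inactive particles at a vertex become active as soon as an active particle visits that vertex. Formally, let $T(v,u)$ be the smallest $k\in\{0,\dots,\ell\}$ such that some particle started at $v$ is at $u$ after $k$ steps ($\infty$ if none). The activation time is $\mathrm{AT}(o,u)=\inf\sum_{i=1}^m T(v_{i-1},v_i)$, the infimum being over $m\ge0$ and sequences $o=v_0,v_1,\dots,v_m=u$ with all $T(v_{i-1},v_i)<\infty$ ($\inf\emptyset=\infty$; in particular $\mathrm{AT}(o,o)=0$). Set $\mathcal{A}(t)=\{u:\mathrm{AT}(o,u)\le t\}$. $\mathbb{P}$ is the law of this model. *)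

theory Defs
  imports "HOL-Probability.Probability"
begin

text \<open>\<open>\<int>\<^sup>d\<close> is the type \<open>int ^ 'd\<close> with \<open>d = CARD('d)\<close>; the origin is \<open>0\<close>.\<close>

definition linf_norm :: "int ^ 'd \<Rightarrow> real"
  where "linf_norm x = real_of_int (Max (range (\<lambda>i. \<bar>x $ i\<bar>)))"

definition lattice_box :: "real \<Rightarrow> (int ^ 'd) set"
  where "lattice_box L = {x. \<forall>i. - L \<le> real_of_int (x $ i) \<and> real_of_int (x $ i) \<le> L}"

text \<open>A transition kernel on \<open>'v\<close> is a map \<open>Q :: 'v \<Rightarrow> 'v pmf\<close>, so that \<open>pmf (Q x) y\<close> is \<open>Q(x,y)\<close>;
  nonnegativity and row sums \<open>1\<close> are part of the type.\<close>

definition symmetric_kernel :: "('v \<Rightarrow> 'v pmf) \<Rightarrow> bool"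
  where "symmetric_kernel Q \<longleftrightarrow> (\<forall>x y. pmf (Q x) y = pmf (Q y) x)"

definition translation_invariant_kernel :: "('v::group_add \<Rightarrow> 'v pmf) \<Rightarrow> bool"
  where "translation_invariant_kernel Q \<longleftrightarrow> (\<forall>x y. pmf (Q x) y = pmf (Q 0) (y - x))"

definition heavy_tailed_kernel :: "(int ^ 'd \<Rightarrow> (int ^ 'd) pmf) \<Rightarrow> real \<Rightarrow> bool"
  where "heavy_tailed_kernel Q \<alpha> \<longleftrightarrow> (\<exists>K>0. \<forall>x y. x \<noteq> y \<longrightarrow>
    inverse K * linf_norm (x - y) powr (- (real CARD('d) + \<alpha>)) \<le> pmf (Q x) y \<and>
    pmf (Q x) y \<le> K * linf_norm (x - y) powr (- (real CARD('d) + \<alpha>)))"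

text \<open>The law of the Markov chain with kernel \<open>Q\<close> started at \<open>v\<close>, on infinite trajectories. It is
  obtained from the Ionescu-Tulcea construction, whose \<open>n\<close>-th kernel gives the law of the position
  at time \<open>n\<close> conditioned on the positions at times \<open>0, \<dots>, n - 1\<close>. The lemma
  \<open>emeasure_walk_law\<close> below gives its finite-dimensional distributions.\<close>

fun step_law :: "('v \<Rightarrow> 'v pmf) \<Rightarrow> 'v \<Rightarrow> nat \<Rightarrow> (nat \<Rightarrow> 'v) \<Rightarrow> 'v measure"
  where
    "step_law Q v 0 w = measure_pmf (return_pmf v)"
  | "step_law Q v (Suc n) w = measure_pmf (Q (w n))"

definition walk_law :: "('v \<Rightarrow> 'v pmf) \<Rightarrow> 'v \<Rightarrow> (nat \<Rightarrow> 'v) measure"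
  where "walk_law Q v =
    projective_family.lim UNIV
      (Ionescu_Tulcea.CI (step_law Q v) (\<lambda>_. count_space UNIV)) (\<lambda>_. count_space UNIV)"

lemma Ionescu_Tulcea_step_law:
  fixes Q :: "'v \<Rightarrow> 'v pmf"
  shows "Ionescu_Tulcea (step_law Q v) (\<lambda>_. count_space UNIV)"
proof (rule Ionescu_Tulcea.intro)
  fix i
  show "step_law Q v i \<in> Pi\<^sub>M {0..<i} (\<lambda>_. count_space UNIV) \<rightarrow>\<^sub>M subprob_algebra (count_space UNIV)"
  proof (cases i)
    case 0
    have "step_law Q v 0 = (\<lambda>_. measure_pmf (return_pmf v))"
      by auto
    then show ?thesis
      unfolding 0 by (simp add: measure_pmf_in_subprob_algebra)
  next
    case (Suc n)
    have "(\<lambda>w. measure_pmf (Q (w n)))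
        \<in> Pi\<^sub>M {0..<Suc n} (\<lambda>_. count_space UNIV) \<rightarrow>\<^sub>M subprob_algebra (count_space UNIV)"
      by (rule measurable_compose[OF measurable_component_singleton[of n]])
         (auto simp: measure_pmf_in_subprob_algebra)
    moreover have "step_law Q v (Suc n) = (\<lambda>w. measure_pmf (Q (w n)))"
      by auto
    ultimately show ?thesis
      unfolding Suc by simp
  qed
next
  fix i :: nat and w :: "nat \<Rightarrow> 'v"
  assume "w \<in> space (Pi\<^sub>M {0..<i} (\<lambda>_. count_space UNIV))"
  show "prob_space (step_law Q v i w)"
    by (cases i) (simp_all add: measure_pmf.prob_space_axioms)
qed

lemma space_walk_law [simp]: "space (walk_law Q v) = UNIV"
  and sets_walk_law [measurable_cong]:
    "sets (walk_law Q v) = sets (Pi\<^sub>M UNIV (\<lambda>_. count_space UNIV))"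
proof -
  interpret Ionescu_Tulcea "step_law Q v" "\<lambda>_. count_space UNIV"
    by (rule Ionescu_Tulcea_step_law)
  show "space (walk_law Q v) = UNIV"
    "sets (walk_law Q v) = sets (Pi\<^sub>M UNIV (\<lambda>_. count_space UNIV))"
    by (simp_all add: walk_law_def space_PiM)
qed

lemma emeasure_walk_law:
  "emeasure (walk_law Q v) {w. \<forall>i\<le>n. w i = p i} =
    (if p 0 = v then \<Prod>i<n. ennreal (pmf (Q (p i)) (p (Suc i))) else 0)"
proof -
  interpret Ionescu_Tulcea "step_law Q v" "\<lambda>_. count_space UNIV"
    by (rule Ionescu_Tulcea_step_law)
  define A where "A n = (\<Pi>\<^sub>E i\<in>{0..<Suc n}. {p i})" for n
  have A [measurable]: "A n \<in> sets (Pi\<^sub>M {0..<Suc n} (\<lambda>_. count_space UNIV))" for n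
    unfolding A_def by (intro sets_PiM_I_finite) auto
  have und: "(\<lambda>_. undefined) \<in> space (Pi\<^sub>M {0..<0::nat} (\<lambda>_. count_space (UNIV :: 'a set)))"
    by (simp add: space_PiM)
  have C: "emeasure (C 0 (Suc n) (\<lambda>_. undefined)) (A n) =
    (if p 0 = v then \<Prod>i<n. ennreal (pmf (Q (p i)) (p (Suc i))) else 0)" for n
  proof (induction n)
    case 0
    have eq: "C 0 (Suc 0) (\<lambda>_. undefined) = eP 0 (\<lambda>_. undefined)"
      using bind_return[OF measurable_eP[of 0] und] by simp
    show ?case
      unfolding eq by (subst emeasure_eP)
        (auto simp: A_def space_PiM PiE_iff extensional_def emeasure_pmf_single
          indicator_def return_def)
  next
    case (Suc n)
    have "emeasure (C 0 (Suc (Suc n)) (\<lambda>_. undefined)) (A (Suc n)) =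
        (\<integral>\<^sup>+w. emeasure (eP (Suc n) w) (A (Suc n)) \<partial>C 0 (Suc n) (\<lambda>_. undefined))"
      unfolding C.simps(2)[of 0 "Suc n"] add_0
      by (rule emeasure_bind[where N="Pi\<^sub>M {0..<Suc (Suc n)} (\<lambda>_. count_space UNIV)"])
         (use und space_C[OF und, of "Suc n"] sets_C[OF und, of "Suc n"] measurable_eP[of "Suc n"] in
           \<open>auto simp: space_PiM cong: measurable_cong_sets\<close>)
    also have "\<dots> = (\<integral>\<^sup>+w. ennreal (pmf (Q (p n)) (p (Suc n))) * indicator (A n) w
        \<partial>C 0 (Suc n) (\<lambda>_. undefined))"
    proof (rule nn_integral_cong)
      fix w assume "w \<in> space (C 0 (Suc n) (\<lambda>_. undefined))"
      then have w: "w \<in> space (Pi\<^sub>M {0..<Suc n} (\<lambda>_. count_space UNIV))"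
        using space_C[OF und, of "Suc n"] by simp
      have *: "(\<lambda>x. w(Suc n := x)) -` A (Suc n) = (if w \<in> A n then {p (Suc n)} else {})"
        using w by (fastforce simp: A_def space_PiM PiE_iff extensional_def Ball_def less_Suc_eq
            split: if_splits)
      have "w n = p n" if "w \<in> A n"
        using that by (auto simp: A_def PiE_iff)
      with * show "emeasure (eP (Suc n) w) (A (Suc n)) =
          ennreal (pmf (Q (p n)) (p (Suc n))) * indicator (A n) w"
        by (subst emeasure_eP[OF w A]) (auto simp: emeasure_pmf_single)
    qed
    also have "\<dots> = ennreal (pmf (Q (p n)) (p (Suc n))) * emeasure (C 0 (Suc n) (\<lambda>_. undefined)) (A n)"
      using sets_C[OF und, of "Suc n"] by (subst nn_integral_cmult_indicator) auto
    finally show ?case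
      using Suc.IH by (simp add: mult.commute del: C.simps)
  qed
  have "{w. \<forall>i\<le>n. w i = p i} = PF.emb UNIV {0..<Suc n} (A n)"
    by (auto simp: A_def prod_emb_def PiE_iff space_PiM less_Suc_eq_le)
  then have "emeasure (walk_law Q v) {w. \<forall>i\<le>n. w i = p i} = emeasure (CI {0..<Suc n}) (A n)"
    by (simp add: walk_law_def lim)
  also have "\<dots> = emeasure (C 0 (Suc n) (\<lambda>_. undefined)) (A n)"
    by (subst emeasure_CI[where n="Suc n"]) (auto simp: A_def prod_emb_id PiE_iff)
  finally show ?thesis
    by (simp only: C)
qed

lemma prob_space_walk_law: "prob_space (walk_law Q v)"
proof
  interpret Ionescu_Tulcea "step_law Q v" "\<lambda>_. count_space UNIV"
    by (rule Ionescu_Tulcea_step_law)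
  have "prob_space (CI {})"
    by (rule PF.prob_space_P) auto
  moreover have "emeasure (walk_law Q v) UNIV = emeasure (CI {}) (space (CI {}))"
    using lim[of "{}" "space (CI {})"] PF.space_P[of "{}"]
    by (simp add: walk_law_def prod_emb_def space_PiM restrict_def vimage_def sets_PiM_empty)
  ultimately show "emeasure (walk_law Q v) (space (walk_law Q v)) = 1"
    by (simp add: prob_space.emeasure_space_1)
qed

text \<open>A configuration is a pair \<open>(N, X)\<close>: \<open>N v\<close> is the number of particles initially at \<open>v\<close>, and
  \<open>X (v, i) k\<close> is the position after \<open>k\<close> steps of the particle number \<open>i\<close> of \<open>v\<close>. Trajectories are
  provided for all \<open>i\<close>, but only those with \<open>i < N v\<close> belong to actual particles.\<close>

definition frog_law ::
    "('v \<Rightarrow> 'v pmf) \<Rightarrow> real \<Rightarrow> (('v \<Rightarrow> nat) \<times> ('v \<times> nat \<Rightarrow> nat \<Rightarrow> 'v)) measure"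
  where "frog_law Q lam =
    (\<Pi>\<^sub>M v\<in>UNIV. measure_pmf (poisson_pmf lam)) \<Otimes>\<^sub>M (\<Pi>\<^sub>M (v, i)\<in>UNIV. walk_law Q v)"

lemma prob_space_frog_law: "prob_space (frog_law Q lam)"
  unfolding frog_law_def
  by (intro prob_space_pair prob_space_PiM)
     (auto simp: prob_space_walk_law measure_pmf.prob_space_axioms split: prod.split)

text \<open>Times are extended naturals; infima are taken in \<^typ>\<open>enat\<close>, where \<open>Inf {} = \<infinity>\<close>.\<close>

definition hit_time ::
    "nat \<Rightarrow> ('v \<Rightarrow> nat) \<Rightarrow> ('v \<times> nat \<Rightarrow> nat \<Rightarrow> 'v) \<Rightarrow> 'v \<Rightarrow> 'v \<Rightarrow> enat"
  where "hit_time l N X v u = Inf {enat k |k. k \<le> l \<and> (\<exists>i<N v. X (v, i) k = u)}"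

definition activation_time ::
    "nat \<Rightarrow> ('v \<Rightarrow> nat) \<Rightarrow> ('v \<times> nat \<Rightarrow> nat \<Rightarrow> 'v) \<Rightarrow> 'v \<Rightarrow> 'v \<Rightarrow> enat"
  where "activation_time l N X v u =
    Inf {\<Sum>i<m. hit_time l N X (p i) (p (Suc i)) |m p.
      p 0 = v \<and> p m = u \<and> (\<forall>i<m. hit_time l N X (p i) (p (Suc i)) < \<infinity>)}"

definition activated ::
    "nat \<Rightarrow> ('v::zero \<Rightarrow> nat) \<Rightarrow> ('v \<times> nat \<Rightarrow> nat \<Rightarrow> 'v) \<Rightarrow> real \<Rightarrow> 'v set"
  where "activated l N X t = {u. ereal_of_enat (activation_time l N X 0 u) \<le> ereal t}"

end

theory Submission
  imports Defs
begin

text \<open>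
  Draw an edge from \<open>v\<close> to \<open>u\<close> if a particle of \<open>v\<close> visits \<open>u\<close> within \<open>l\<close> steps. Distinct vertices have
  independent sets of outgoing edges, an edge \<open>v \<rightarrow> u\<close> has probability \<open>O(\<bar>v - u\<bar> powr - s)\<close> with
  \<open>s = d + \<alpha>\<close>, and \<open>activated\<close> at time \<open>t\<close> lies in the graph ball of radius \<open>t\<close>. So it suffices to
  bound the growth of the balls of a directed long-range percolation graph with \<open>d < s < 2 * d\<close>.

  A geodesic of length at most \<open>n\<close> from \<open>x\<close> to \<open>y\<close> has an edge of length at least \<open>\<bar>x - y\<bar> / n\<close>. Exploring
  the ball up to that edge makes the two remaining parts independent of it, whence
  \<open>P(x \<rightarrow> y in n steps) \<le> K * n powr s * \<bar>x - y\<bar> powr - s * (\<Sum>k<n. S k * S (n - 1 - k))\<close>, where \<open>S k\<close> bounds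
  the expected size of a ball of radius \<open>k\<close>. Summing the minimum of this and 1 over \<open>y\<close> gives, up to
  a power of \<open>n\<close>, \<open>S n \<le> (max k. S k * S (n - 1 - k)) powr (d / s)\<close>. As \<open>2 powr (1 / \<Delta>) = 2 * d / s\<close>, the
  solution is \<open>S n = exp (C * n powr (1 / \<Delta>))\<close> divided by a power of \<open>n\<close>, and Borel-Cantelli over \<open>n\<close>
  places the ball of radius \<open>c * (ln L) powr \<Delta>\<close> in the box of radius \<open>sqrt L\<close>.
\<close>

section \<open>Balls in directed graphs\<close>

text \<open>Only the tails of edges must lie in \<open>V\<close>; heads are arbitrary. Hence the
  restricted ball is a function of the rows of \<open>V\<close> alone.\<close>

fun gball :: "('v \<Rightarrow> 'v \<Rightarrow> bool) \<Rightarrow> 'v set \<Rightarrow> nat \<Rightarrow> 'v \<Rightarrow> 'v set" where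
  "gball E V 0 x = {x}"
| "gball E V (Suc n) x = gball E V n x \<union> {u. \<exists>v \<in> gball E V n x \<inter> V. E v u}"

text \<open>The vertices whose rows are read to find the ball of radius \<open>n\<close>: empty for
  \<open>n = 0\<close>, the ball of radius \<open>n - 1\<close> otherwise.\<close>

definition gball_less :: "('v \<Rightarrow> 'v \<Rightarrow> bool) \<Rightarrow> 'v set \<Rightarrow> nat \<Rightarrow> 'v \<Rightarrow> 'v set" where
  "gball_less E V n x = (\<Union>j<n. gball E V j x)"

lemma gball_mono: "m \<le> n \<Longrightarrow> gball E V m x \<subseteq> gball E V n x"
  by (rule lift_Suc_mono_le[where f="\<lambda>n. gball E V n x"]) auto

lemma gball_less_mono: "m \<le> n \<Longrightarrow> gball_less E V m x \<subseteq> gball_less E V n x"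
  by (fastforce simp: gball_less_def)

lemma gball_mono_set: "V \<subseteq> W \<Longrightarrow> gball E V n x \<subseteq> gball E W n x"
  by (induction n) auto

lemma center_in_gball: "x \<in> gball E V n x"
  using gball_mono[of 0 n E V x] by auto

lemma gball_less_subset: "gball_less E V (Suc n) x = gball E V n x"
  unfolding gball_less_def using gball_mono[of _ n E V x] by (fastforce simp: less_Suc_eq_le)

text \<open>A ball of radius at most \<open>n\<close> reads only rows of vertices at distance less
  than \<open>n\<close>, so sets of admissible tails that agree there give the same balls.\<close>

lemma gball_cong_on:
  assumes "gball_less E V n x \<inter> V = gball_less E V n x \<inter> W" "j \<le> n"
  shows "gball E V j x = gball E W j x"
  using assms(2)
proof (induction j)
  case (Suc j)
  then have "gball E V j x \<subseteq> gball_less E V n x"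
    by (force simp: gball_less_def)
  with Suc assms(1) have "gball E V j x \<inter> V = gball E W j x \<inter> W"
    by auto
  with Suc show ?case by auto
qed simp

text \<open>The explored set behaves like a stopping set: if the exploration sees exactly
  \<open>A\<close>, every row it has read belongs to \<open>A\<close>, and forbidding the other rows
  changes nothing.\<close>

lemma gball_less_eq_iff:
  "gball_less E UNIV n x = A \<longleftrightarrow> gball_less E A n x = A"
  and gball_eq_of_gball_less:
  "gball_less E A n x = A \<Longrightarrow> gball E UNIV n x = gball E A n x"
proof -
  have less: "gball_less E V n x = gball_less E W n x" if "\<And>j. j \<le> n \<Longrightarrow> gball E V j x = gball E W j x"
    for V W using that by (auto simp: gball_less_def)
  have 1: "gball E UNIV j x = gball E A j x" if "gball_less E UNIV n x = A" "j \<le> n" for j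
    by (rule gball_cong_on[where n=n]) (use that in auto)
  have 2: "gball E A j x = gball E UNIV j x" if "gball_less E A n x = A" "j \<le> n" for j
    by (rule gball_cong_on[where n=n]) (use that in auto)
  show "gball_less E UNIV n x = A \<longleftrightarrow> gball_less E A n x = A"
    using less[OF 1] less[OF 2] by metis
  show "gball_less E A n x = A \<Longrightarrow> gball E UNIV n x = gball E A n x"
    using 2[of n] by simp
qed

text \<open>Along a geodesic, the initial segment only uses rows of vertices closer to \<open>x\<close> than \<open>u\<close>, and the
  final segment only rows of vertices farther from \<open>x\<close> than \<open>u\<close>.\<close>

lemma geodesic_edges:
  fixes len :: "'v \<Rightarrow> 'v \<Rightarrow> real"
  assumes len0: "\<And>a. len a a = 0" and tri: "\<And>a b c. len a c \<le> len a b + len b c"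
    and "y \<in> gball E UNIV m x" "y \<notin> gball_less E UNIV m x"
    and "\<And>k u w. k < m \<Longrightarrow> u \<in> gball E UNIV k x \<Longrightarrow> u \<notin> gball_less E UNIV k x \<Longrightarrow> E u w \<Longrightarrow>
        y \<in> gball E (- insert u (gball_less E UNIV k x)) (m - 1 - k) w \<Longrightarrow> len u w < c"
  shows "len x y \<le> m * c \<and> (0 < m \<longrightarrow> len x y < m * c)"
  using assms(3-)
proof (induction m arbitrary: y)
  case 0
  then show ?case by (auto simp: len0)
next
  case (Suc m)
  have "y \<notin> gball E UNIV m x"
    using Suc.prems(2) by (simp add: gball_less_subset)
  with Suc.prems(1) obtain v where v: "v \<in> gball E UNIV m x" "E v y"
    by auto
  have vless: "v \<notin> gball_less E UNIV m x"
  proof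
    assume "v \<in> gball_less E UNIV m x"
    then obtain j where "j < m" "v \<in> gball E UNIV j x"
      by (auto simp: gball_less_def)
    with v have "y \<in> gball E UNIV (Suc j) x" "Suc j \<le> m" by auto
    with \<open>y \<notin> gball E UNIV m x\<close> gball_mono[of "Suc j" m E UNIV x] show False by auto
  qed
  \<comment> \<open>For the last edge of the geodesic the final segment has length 0, so it avoids
    any set.\<close>
  have "len v y < c"
    by (rule Suc.prems(3)[of m]) (use v vless in auto)
  moreover have "len x v \<le> m * c \<and> (0 < m \<longrightarrow> len x v < m * c)"
  proof (rule Suc.IH[OF v(1) vless])
    fix k u w
    assume k: "k < m" and u: "u \<in> gball E UNIV k x" "u \<notin> gball_less E UNIV k x" "E u w"
      and vw: "v \<in> gball E (- insert u (gball_less E UNIV k x)) (m - 1 - k) w"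
    \<comment> \<open>\<open>v\<close> is at distance exactly \<open>m\<close>, hence outside the
      set to be avoided, and its row may extend the path from \<open>w\<close> by the edge to
      \<open>y\<close>.\<close>
    have "insert u (gball_less E UNIV k x) \<subseteq> gball_less E UNIV m x"
      using k u gball_less_mono[of k m E UNIV x] by (auto simp: gball_less_def)
    with vless have "v \<in> - insert u (gball_less E UNIV k x)"
      by blast
    with vw v(2) have "y \<in> gball E (- insert u (gball_less E UNIV k x)) (Suc (m - 1 - k)) w"
      unfolding gball.simps by blast
    moreover have "Suc (m - 1 - k) = Suc m - 1 - k"
      using k by simp
    ultimately have "y \<in> gball E (- insert u (gball_less E UNIV k x)) (Suc m - 1 - k) w"
      by metis
    with k u show "len u w < c"
      by (meson Suc.prems(3) less_SucI)
  qed
  ultimately show ?case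
    using tri[of x y v] by (auto simp: algebra_simps)
qed

text \<open>Take a geodesic, of length \<open>m \<le> n\<close>. If all its edges were shorter than
  \<open>len x y / n\<close>, the triangle inequality would give
  \<open>len x y < m * (len x y / n) \<le> len x y\<close>. The radius \<open>m - 1 - k\<close> of
  the final segment is then relaxed to \<open>n - 1 - k\<close>.\<close>

lemma gball_long_edge:
  fixes len :: "'v \<Rightarrow> 'v \<Rightarrow> real"
  assumes len0: "\<And>a. len a a = 0" and tri: "\<And>a b c. len a c \<le> len a b + len b c"
    and nonneg: "\<And>a b. 0 \<le> len a b"
    and y: "y \<in> gball E UNIV n x" "x \<noteq> y"
  obtains k u w where "k < n" "u \<in> gball E UNIV k x" "u \<notin> gball_less E UNIV k x" "E u w"
    "len x y / n \<le> len u w" "y \<in> gball E (- insert u (gball_less E UNIV k x)) (n - 1 - k) w"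
proof -
  define m where "m = (LEAST m. y \<in> gball E UNIV m x)"
  have m: "y \<in> gball E UNIV m x" "m \<le> n"
    using y(1) unfolding m_def by (auto intro: LeastI Least_le)
  have notless: "y \<notin> gball_less E UNIV m x"
    using not_less_Least[of _ "\<lambda>m. y \<in> gball E UNIV m x"] unfolding m_def gball_less_def by auto
  have "0 < m"
    using m(1) y(2) by (cases m) auto
  have "\<not> len x y < m * (len x y / n)"
  proof -
    have "real m * (len x y / n) \<le> n * (len x y / n)"
      using m(2) nonneg by (intro mult_right_mono) auto
    then show ?thesis using m(2) \<open>0 < m\<close> by simp
  qed
  then obtain k u w where k: "k < m" "u \<in> gball E UNIV k x" "u \<notin> gball_less E UNIV k x" "E u w"
    "y \<in> gball E (- insert u (gball_less E UNIV k x)) (m - 1 - k) w" "\<not> len u w < len x y / n"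
    using geodesic_edges[of len, OF len0 tri m(1) notless, of "len x y / n"] \<open>0 < m\<close> by blast
  moreover have "m - 1 - k \<le> n - 1 - k" "k < n"
    using m(2) k(1) by auto
  ultimately show thesis
    using that[of k u w] gball_mono[of "m - 1 - k" "n - 1 - k" E "- insert u (gball_less E UNIV k x)" w] by auto
qed

section \<open>Random directed graphs with independent rows\<close>

text \<open>The union bound with the sum written as an integral over counting measure, so that sums
  over vertices and pairs need no enumeration.\<close>

lemma emeasure_UN_le_nn_integral:
  assumes sets [measurable]: "\<And>i. i \<in> I \<Longrightarrow> X i \<in> sets M" and I [simp]: "countable I"
  shows "emeasure M (\<Union>(X ` I)) \<le> (\<integral>\<^sup>+i. emeasure M (X i) \<partial>count_space I)"
proof -
  have le: "indicator (\<Union>(X ` I)) x \<le> (\<integral>\<^sup>+i. indicator (X i) x \<partial>count_space I)" for x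
  proof (cases "x \<in> \<Union>(X ` I)")
    case True
    then obtain j where j: "x \<in> X j" "j \<in> I" by auto
    have "(\<integral>\<^sup>+i. indicator {j} i \<partial>count_space I) \<le> (\<integral>\<^sup>+i. indicator (X i) x \<partial>count_space I :: ennreal)"
      using j by (intro nn_integral_mono) (auto simp: indicator_def)
    with j True show ?thesis by simp
  qed simp
  note sets.countable_UN'[unfolded subset_eq, measurable]
  have "emeasure M (\<Union>(X ` I)) = (\<integral>\<^sup>+x. indicator (\<Union>(X ` I)) x \<partial>M)"
    by simp
  also have "\<dots> \<le> (\<integral>\<^sup>+x. \<integral>\<^sup>+i. indicator (X i) x \<partial>count_space I \<partial>M)"
    by (intro nn_integral_mono le)
  also have "\<dots> = (\<integral>\<^sup>+i. \<integral>\<^sup>+x. indicator (X i) x \<partial>M \<partial>count_space I)"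
    by (simp add: nn_integral_count_space_nn_integral)
  finally show ?thesis
    by (simp cong: nn_integral_cong_simp)
qed

text \<open>\<open>\<G> v\<close> carries the information on the edges leaving \<open>v\<close>.
  Different rows are independent, but edges with a common tail may depend on each other, as they do
  when one particle visits several vertices.\<close>

locale random_digraph = prob_space M for M :: "'a measure" +
  fixes E :: "'a \<Rightarrow> 'v::countable \<Rightarrow> 'v \<Rightarrow> bool" and \<G> :: "'v \<Rightarrow> 'a set set"
  assumes indep_rows: "indep_sets \<G> UNIV"
    and Int_stable_rows: "\<And>v. Int_stable (\<G> v)"
    and edge_in_rows: "\<And>v u. {\<omega>\<in>space M. E \<omega> v u} \<in> \<G> v"
begin

text \<open>The measure serves only to carry the generated sigma-algebra, so that measurability with
  respect to the rows of \<open>V\<close> can be derived as usual.\<close>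

definition rows :: "'v set \<Rightarrow> 'a measure" where
  "rows V = sigma (space M) (\<Union>v\<in>V. \<G> v)"

lemma \<G>_events: "\<G> v \<subseteq> events"
  using indep_rows by (auto simp: indep_sets_def)

lemma space_rows [simp]: "space (rows V) = space M"
  and sets_rows: "sets (rows V) = sigma_sets (space M) (\<Union>v\<in>V. \<G> v)"
proof -
  have *: "(\<Union>v\<in>V. \<G> v) \<subseteq> Pow (space M)"
    using \<G>_events sets.space_closed by fastforce
  show "space (rows V) = space M" "sets (rows V) = sigma_sets (space M) (\<Union>v\<in>V. \<G> v)"
    unfolding rows_def using * by (simp_all add: space_measure_of_conv)
qed

lemma sets_rows_events: "sets (rows V) \<subseteq> events"
  unfolding sets_rows using \<G>_events by (intro sets.sigma_sets_subset) auto

lemma gball_in_rows: "{\<omega>\<in>space M. y \<in> gball (E \<omega>) V n x} \<in> sets (rows V)"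
proof (induction n arbitrary: y)
  case 0
  have "{\<omega>\<in>space M. y \<in> {x}} = (if y = x then space (rows V) else {})" by auto
  also have "\<dots> \<in> sets (rows V)" by (simp del: space_rows)
  finally show ?case by simp
next
  case (Suc n)
  have edge: "{\<omega>\<in>space M. E \<omega> v y} \<in> sets (rows V)" if "v \<in> V" for v
    unfolding sets_rows using edge_in_rows[of v y] that by (intro sigma_sets.Basic) auto
  have "{\<omega>\<in>space M. y \<in> gball (E \<omega>) V (Suc n) x} = {\<omega>\<in>space M. y \<in> gball (E \<omega>) V n x} \<union>
      (\<Union>v\<in>V. {\<omega>\<in>space M. v \<in> gball (E \<omega>) V n x} \<inter> {\<omega>\<in>space M. E \<omega> v y})"
    by auto
  also have "\<dots> \<in> sets (rows V)"
    using Suc edge by (intro sets.Un sets.countable_UN'' sets.Int) auto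
  finally show ?case .
qed

lemma gball_less_in_rows: "{\<omega>\<in>space M. y \<in> gball_less (E \<omega>) V n x} \<in> sets (rows V)"
proof -
  have "{\<omega>\<in>space M. y \<in> gball_less (E \<omega>) V n x} = (\<Union>j<n. {\<omega>\<in>space M. y \<in> gball (E \<omega>) V j x})"
    by (auto simp: gball_less_def)
  also have "\<dots> \<in> sets (rows V)"
    using gball_in_rows by (intro sets.finite_UN) auto
  finally show ?thesis .
qed

lemma edge_event [measurable]: "Measurable.pred M (\<lambda>\<omega>. E \<omega> v u)"
  using edge_in_rows \<G>_events by (auto simp: pred_def)

text \<open>The set of admissible tails may be random here, as the complement of an explored set
  is.\<close>

lemma gball_event [measurable (raw)]:
  assumes [measurable]: "\<And>v. Measurable.pred M (\<lambda>\<omega>. v \<in> V \<omega>)"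
  shows "Measurable.pred M (\<lambda>\<omega>. y \<in> gball (E \<omega>) (V \<omega>) n x)"
proof (induction n arbitrary: y)
  case (Suc n)
  note Suc [measurable]
  show ?case by (simp add: Bex_def) measurable
qed simp

lemma gball_less_event [measurable]: "Measurable.pred M (\<lambda>\<omega>. y \<in> gball_less (E \<omega>) UNIV n x)"
  unfolding gball_less_def by simp

text \<open>The event \<open>gball_less \<dots> = A\<close> is decided by the rows of \<open>A\<close> alone.\<close>

lemma explored_in_rows:
  "{\<omega>\<in>space M. gball_less (E \<omega>) UNIV k x = A \<and> u \<in> gball (E \<omega>) UNIV k x} \<in> sets (rows A)"
proof -
  have "{\<omega>\<in>space M. gball_less (E \<omega>) UNIV k x = A \<and> u \<in> gball (E \<omega>) UNIV k x} =
     {\<omega>\<in>space M. gball_less (E \<omega>) A k x = A \<and> u \<in> gball (E \<omega>) A k x}"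
    using gball_less_eq_iff[of _ k x A] gball_eq_of_gball_less[of _ A k x] by auto
  also have "\<dots> = {\<omega>\<in>space (rows A). (\<forall>v. v \<in> gball_less (E \<omega>) A k x \<longleftrightarrow> v \<in> A) \<and> u \<in> gball (E \<omega>) A k x}"
    by auto
  also have "\<dots> \<in> sets (rows A)"
  proof -
    have [measurable]: "Measurable.pred (rows A) (\<lambda>\<omega>. v \<in> gball_less (E \<omega>) A k x)"
       "Measurable.pred (rows A) (\<lambda>\<omega>. v \<in> gball (E \<omega>) A k x)" for v
      using gball_less_in_rows gball_in_rows by (auto simp: pred_def)
    show ?thesis by measurable
  qed
  finally show ?thesis .
qed

text \<open>\<open>A\<close>, \<open>{u}\<close> and the complement of \<open>insert u A\<close> are
  disjoint blocks of vertices, so the sigma-algebras generated by their rows are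
  independent.\<close>

lemma indep_rows3:
  assumes "u \<notin> A" and "a \<in> sets (rows A)" "b \<in> sets (rows {u})" "c \<in> sets (rows (- insert u A))"
  shows "emeasure M (a \<inter> b \<inter> c) = emeasure M a * emeasure M b * emeasure M c"
proof -
  define I where "I j = (if j = 0 then A else if j = 1 then {u} else - insert u A)" for j :: nat
  have "indep_sets (\<lambda>j. sigma_sets (space M) (\<Union>v\<in>I j. \<G> v)) {0,1,2::nat}"
  proof (rule indep_sets_collect_sigma)
    show "indep_sets \<G> (\<Union>j\<in>{0,1,2}. I j)"
      by (rule indep_sets_mono_index[OF _ indep_rows]) auto
    show "disjoint_family_on I {0,1,2}"
      using assms(1) by (auto simp: disjoint_family_on_def I_def)
  qed (rule Int_stable_rows)
  then have ind: "indep_sets (\<lambda>j. sets (rows (I j))) {0,1,2::nat}"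
    by (simp add: sets_rows)
  have "prob (\<Inter>j\<in>{0,1,2::nat}. (if j = 0 then a else if j = 1 then b else c)) =
     (\<Prod>j\<in>{0,1,2::nat}. prob (if j = 0 then a else if j = 1 then b else c))"
    by (rule indep_setsD[OF ind]) (use assms in \<open>auto simp: I_def\<close>)
  moreover have "(\<Inter>j\<in>{0,1,2::nat}. (if j = 0 then a else if j = 1 then b else c)) = a \<inter> b \<inter> c"
    by auto
  ultimately show ?thesis
    by (simp add: emeasure_eq_measure ennreal_mult mult.assoc flip: ennreal_mult)
qed

section \<open>Connection probabilities and their recursion\<close>

abbreviation reach_prob :: "nat \<Rightarrow> 'v \<Rightarrow> 'v \<Rightarrow> ennreal" where
  "reach_prob n x y \<equiv> emeasure M {\<omega>\<in>space M. y \<in> gball (E \<omega>) UNIV n x}"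

abbreviation edge_prob :: "'v \<Rightarrow> 'v \<Rightarrow> ennreal" where
  "edge_prob v u \<equiv> emeasure M {\<omega>\<in>space M. E \<omega> v u}"

text \<open>Sum over the possible values \<open>A\<close> of the explored set. For each value, the
  exploration is decided by the rows of \<open>A\<close>, the edge by the row of \<open>u\<close>
  and the last path by the remaining rows, so the probabilities multiply. Almost sure finiteness
  leaves only countably many \<open>A\<close>.\<close>

lemma through_edge:
  assumes fin: "AE \<omega> in M. finite (gball_less (E \<omega>) UNIV k x)"
  shows "emeasure M {\<omega>\<in>space M. u \<in> gball (E \<omega>) UNIV k x \<and> u \<notin> gball_less (E \<omega>) UNIV k x \<and> E \<omega> u w \<and>
      y \<in> gball (E \<omega>) (- insert u (gball_less (E \<omega>) UNIV k x)) j w}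
    \<le> reach_prob k x u * edge_prob u w * reach_prob j w y"
proof -
  define I where "I = {A. finite A \<and> u \<notin> A}"
  have cI: "countable I"
    by (rule countable_subset[OF _ countable_Collect_finite]) (auto simp: I_def)
  define a where "a A = {\<omega>\<in>space M. gball_less (E \<omega>) UNIV k x = A \<and> u \<in> gball (E \<omega>) UNIV k x}" for A
  define b where "b = {\<omega>\<in>space M. E \<omega> u w}"
  define c where "c A = {\<omega>\<in>space M. y \<in> gball (E \<omega>) (- insert u A) j w}" for A
  have a: "a A \<in> sets (rows A)" for A
    unfolding a_def by (rule explored_in_rows)
  have b: "b \<in> sets (rows {u})"
    unfolding b_def sets_rows using edge_in_rows by (intro sigma_sets.Basic) auto
  have c: "c A \<in> sets (rows (- insert u A))" for A
    unfolding c_def by (rule gball_in_rows)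
  have abc [measurable]: "a A \<in> events" "b \<in> events" "c A \<in> events" for A
    using a b c sets_rows_events by blast+
  have "emeasure M {\<omega>\<in>space M. u \<in> gball (E \<omega>) UNIV k x \<and> u \<notin> gball_less (E \<omega>) UNIV k x \<and> E \<omega> u w \<and>
      y \<in> gball (E \<omega>) (- insert u (gball_less (E \<omega>) UNIV k x)) j w}
    \<le> emeasure M (\<Union>A\<in>I. a A \<inter> b \<inter> c A)"
  proof (rule emeasure_mono_AE)
    show "AE \<omega> in M. \<omega> \<in> {\<omega>\<in>space M. u \<in> gball (E \<omega>) UNIV k x \<and> u \<notin> gball_less (E \<omega>) UNIV k x \<and> E \<omega> u w \<and>
      y \<in> gball (E \<omega>) (- insert u (gball_less (E \<omega>) UNIV k x)) j w} \<longrightarrow> \<omega> \<in> (\<Union>A\<in>I. a A \<inter> b \<inter> c A)"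
      using fin by eventually_elim (auto simp: I_def a_def b_def c_def)
    show "(\<Union>A\<in>I. a A \<inter> b \<inter> c A) \<in> events"
      by (intro sets.countable_UN''[OF cI] sets.Int abc)
  qed
  also have "\<dots> = (\<integral>\<^sup>+A. emeasure M (a A \<inter> b \<inter> c A) \<partial>count_space I)"
  proof (rule emeasure_UN_countable[OF _ cI])
    show "disjoint_family_on (\<lambda>A. a A \<inter> b \<inter> c A) I"
      by (auto simp: disjoint_family_on_def a_def)
  qed measurable
  also have "\<dots> = (\<integral>\<^sup>+A. emeasure M (a A) * emeasure M b * emeasure M (c A) \<partial>count_space I)"
    by (intro nn_integral_cong indep_rows3[OF _ a b c]) (auto simp: I_def)
  \<comment> \<open>Admitting all tails in the last path removes its dependence on \<open>A\<close>,
    so that only the first factor remains to be summed.\<close>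
  also have "\<dots> \<le> (\<integral>\<^sup>+A. emeasure M (a A) * (emeasure M b * reach_prob j w y) \<partial>count_space I)"
    unfolding mult.assoc
  proof (intro nn_integral_mono mult_left_mono emeasure_mono)
    fix A show "c A \<subseteq> {\<omega>\<in>space M. y \<in> gball (E \<omega>) UNIV j w}"
      unfolding c_def using gball_mono_set[of "- insert u A" UNIV _ j w] by auto
  qed auto
  also have "\<dots> = (\<integral>\<^sup>+A. emeasure M (a A) \<partial>count_space I) * (emeasure M b * reach_prob j w y)"
    by (rule nn_integral_multc) auto
  also have "(\<integral>\<^sup>+A. emeasure M (a A) \<partial>count_space I) = emeasure M (\<Union>A\<in>I. a A)"
  proof (rule emeasure_UN_countable[OF _ cI, symmetric])
    show "disjoint_family_on a I"
      by (auto simp: disjoint_family_on_def a_def)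
  qed measurable
  also have "\<dots> \<le> reach_prob k x u"
    by (rule emeasure_mono) (auto simp: a_def)
  finally show ?thesis
    by (simp add: b_def mult.assoc mult_right_mono)
qed

text \<open>Union bound over the position \<open>k\<close> and the endpoints of a long edge. The
  uniform bound \<open>e\<close> lets the sums over \<open>u\<close> and \<open>w\<close> separate:
  one is the expected size of a ball around \<open>x\<close>, the other the expected number of
  starting points that reach \<open>y\<close>.\<close>

lemma reach_prob_recursion:
  fixes len :: "'v \<Rightarrow> 'v \<Rightarrow> real"
  assumes len0: "\<And>a. len a a = 0" and tri: "\<And>a b c. len a c \<le> len a b + len b c"
    and nonneg: "\<And>a b. 0 \<le> len a b"
    and fin: "\<And>k. k < n \<Longrightarrow> AE \<omega> in M. finite (gball_less (E \<omega>) UNIV k x)"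
    and "x \<noteq> y"
    and edge: "\<And>u w. len x y / n \<le> len u w \<Longrightarrow> edge_prob u w \<le> e"
  shows "reach_prob n x y \<le> e * (\<Sum>k<n. (\<integral>\<^sup>+u. reach_prob k x u \<partial>count_space UNIV) *
      (\<integral>\<^sup>+w. reach_prob (n - 1 - k) w y \<partial>count_space UNIV))"
proof -
  define D where "D k u w = {\<omega>\<in>space M. u \<in> gball (E \<omega>) UNIV k x \<and> u \<notin> gball_less (E \<omega>) UNIV k x \<and> E \<omega> u w \<and>
      y \<in> gball (E \<omega>) (- insert u (gball_less (E \<omega>) UNIV k x)) (n - 1 - k) w}" for k u w
  define S where "S = {(u, w). len x y / n \<le> len u w}"
  have D: "D k u w \<in> events" for k u w
  proof -
    have [measurable]: "Measurable.pred M (\<lambda>\<omega>. v \<in> - insert u (gball_less (E \<omega>) UNIV k x))" for v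
      by simp
    show ?thesis
      unfolding D_def by measurable
  qed
  have "reach_prob n x y \<le> emeasure M (\<Union>k<n. \<Union>p\<in>S. D k (fst p) (snd p))"
  proof (rule emeasure_mono)
    show "{\<omega>\<in>space M. y \<in> gball (E \<omega>) UNIV n x} \<subseteq> (\<Union>k<n. \<Union>p\<in>S. D k (fst p) (snd p))"
    proof clarify
      fix \<omega> assume "\<omega> \<in> space M" "y \<in> gball (E \<omega>) UNIV n x"
      from gball_long_edge[of len, OF len0 tri nonneg this(2) assms(5)]
      obtain k u w where "k < n" "u \<in> gball (E \<omega>) UNIV k x" "u \<notin> gball_less (E \<omega>) UNIV k x" "E \<omega> u w"
        "len x y / n \<le> len u w"
        "y \<in> gball (E \<omega>) (- insert u (gball_less (E \<omega>) UNIV k x)) (n - 1 - k) w"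
        by blast
      with \<open>\<omega> \<in> space M\<close> show "\<omega> \<in> (\<Union>k<n. \<Union>p\<in>S. D k (fst p) (snd p))"
        unfolding D_def S_def by (intro UN_I[of k] UN_I[of "(u, w)"]) auto
    qed
    show "(\<Union>k<n. \<Union>p\<in>S. D k (fst p) (snd p)) \<in> events"
      using D by (intro sets.finite_UN sets.countable_UN'') auto
  qed
  also have "\<dots> \<le> (\<Sum>k<n. emeasure M (\<Union>p\<in>S. D k (fst p) (snd p)))"
    using D by (intro emeasure_subadditive_finite image_subsetI sets.countable_UN'') auto
  also have "\<dots> \<le> (\<Sum>k<n. \<integral>\<^sup>+p. emeasure M (D k (fst p) (snd p)) \<partial>count_space S)"
    using D by (intro sum_mono emeasure_UN_le_nn_integral) auto
  also have "\<dots> \<le> (\<Sum>k<n. \<integral>\<^sup>+p. reach_prob k x (fst p) * e * reach_prob (n - 1 - k) (snd p) y \<partial>count_space S)"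
  proof (intro sum_mono nn_integral_mono)
    fix k p assume "k \<in> {..<n}" "p \<in> space (count_space S)"
    then have "emeasure M (D k (fst p) (snd p)) \<le>
       reach_prob k x (fst p) * edge_prob (fst p) (snd p) * reach_prob (n - 1 - k) (snd p) y"
      unfolding D_def using fin[of k] by (intro through_edge) auto
    also have "\<dots> \<le> reach_prob k x (fst p) * e * reach_prob (n - 1 - k) (snd p) y"
      using edge[of "fst p" "snd p"] \<open>p \<in> _\<close> by (intro mult_right_mono mult_left_mono) (auto simp: S_def)
    finally show "emeasure M (D k (fst p) (snd p)) \<le> reach_prob k x (fst p) * e * reach_prob (n - 1 - k) (snd p) y" .
  qed
  \<comment> \<open>Summing over all pairs instead of the long ones turns the double sum into a
    product.\<close>
  also have "\<dots> \<le> (\<Sum>k<n. \<integral>\<^sup>+p. reach_prob k x (fst p) * e * reach_prob (n - 1 - k) (snd p) y \<partial>count_space UNIV)"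
    by (intro sum_mono) (auto simp: nn_integral_count_space_indicator indicator_def intro!: nn_integral_mono)
  also have "\<dots> = (\<Sum>k<n. \<integral>\<^sup>+u. \<integral>\<^sup>+w. reach_prob k x u * e * reach_prob (n - 1 - k) w y \<partial>count_space UNIV \<partial>count_space UNIV)"
    by (simp add: nn_integral_fst_count_space[symmetric])
  also have "\<dots> = e * (\<Sum>k<n. (\<integral>\<^sup>+u. reach_prob k x u \<partial>count_space UNIV) *
      (\<integral>\<^sup>+w. reach_prob (n - 1 - k) w y \<partial>count_space UNIV))"
    by (simp add: nn_integral_cmult nn_integral_multc sum_distrib_left ac_simps)
  finally show ?thesis .
qed

end

section \<open>The growth function\<close>

lemma ln_le_powr_div:
  fixes x \<theta> :: real
  assumes "0 < x" "0 < \<theta>"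
  shows "ln x \<le> x powr \<theta> / \<theta>"
proof -
  have "\<theta> * ln x = ln (x powr \<theta>)"
    using assms by (simp add: ln_powr)
  also have "\<dots> \<le> x powr \<theta> - 1"
    using assms by (intro ln_le_minus_one) simp
  finally show ?thesis
    using assms by (simp add: field_simps)
qed

text \<open>Concavity of the power \<open>\<theta>\<close>, derived from convexity of the power
  \<open>1 / \<theta>\<close> at the midpoint of \<open>x powr \<theta>\<close> and
  \<open>y powr \<theta>\<close>.\<close>

lemma powr_add_le_two_half:
  fixes x y \<theta> :: real
  assumes "0 < x" "0 < y" "0 < \<theta>" "\<theta> \<le> 1"
  shows "x powr \<theta> + y powr \<theta> \<le> 2 * ((x + y) / 2) powr \<theta>"
proof -
  have "((1 - 1/2) *\<^sub>R (x powr \<theta>) + (1/2) *\<^sub>R (y powr \<theta>)) powr (1 / \<theta>)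
      \<le> (1 - 1/2) * ((x powr \<theta>) powr (1 / \<theta>)) + (1/2) * ((y powr \<theta>) powr (1 / \<theta>))"
    using assms by (intro convex_onD[OF powr_convex]) auto
  then have "((x powr \<theta> + y powr \<theta>) / 2) powr (1 / \<theta>) \<le> (x + y) / 2"
    using assms by (simp add: powr_powr add_divide_distrib)
  then have "(((x powr \<theta> + y powr \<theta>) / 2) powr (1 / \<theta>)) powr \<theta> \<le> ((x + y) / 2) powr \<theta>"
    using assms by (intro powr_mono2) auto
  then show ?thesis
    using assms by (simp add: powr_powr)
qed

text \<open>The exponent \<open>G m = C * m powr \<theta> - D * ln m - E\<close> of the growth function. At \<open>i = j\<close> the leading terms
  cancel; there the logarithm absorbs \<open>b * ln (i + j)\<close> and \<open>E\<close> absorbs the constants, both because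
  \<open>2 * a > 1\<close>. For \<open>i\<close> far below \<open>j\<close> the leading term wins.\<close>

lemma split_inequality:
  fixes a b b' \<theta> :: real
  assumes a: "1/2 < a" "a < 1" and \<theta>: "0 < \<theta>" "\<theta> \<le> 1" "2 powr \<theta> = 2 * a" and b: "0 \<le> b" "0 \<le> b'"
  obtains C D E :: real where "C > 0" "D \<ge> 0" "E \<ge> 0" "\<And>m::real. 1 \<le> m \<Longrightarrow> 0 \<le> C * m powr \<theta> - D * ln m - E"
    "\<And>i j::real. 1 \<le> i \<Longrightarrow> 1 \<le> j \<Longrightarrow> b * ln (i + j) + b' + a * ((C * i powr \<theta> - D * ln i - E) + (C * j powr \<theta> - D * ln j - E))
       \<le> C * (i + j) powr \<theta> - D * ln (i + j) - E"
proof -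
  \<comment> \<open>If \<open>i \<le> \<epsilon> * m\<close>, then \<open>i\<close> contributes at
    most \<open>C * (1 - a) / 2 * m powr \<theta>\<close>, half of the deficit \<open>1 - a\<close>
    in the leading term.\<close>
  define \<epsilon> where "\<epsilon> = ((1 - a) / (2 * a)) powr (1 / \<theta>)"
  have quot: "0 < (1 - a) / (2 * a)" "(1 - a) / (2 * a) < 1"
    using a by (auto simp: field_simps)
  have \<epsilon>\<theta>: "\<epsilon> powr \<theta> = (1 - a) / (2 * a)"
    using quot \<theta> a by (simp add: \<epsilon>_def powr_powr)
  have \<epsilon>: "0 < \<epsilon>"
    using a by (simp add: \<epsilon>_def)
  have half: "\<epsilon> \<le> 1/2"
  proof (rule ccontr)
    assume "\<not> \<epsilon> \<le> 1/2"
    then have "(1/2) powr \<theta> \<le> \<epsilon> powr \<theta>" using \<theta> by (intro powr_mono2) auto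
    moreover have "(1/2) powr \<theta> = 1 / (2 * a)" using \<theta> by (simp add: powr_divide)
    ultimately show False using a unfolding \<epsilon>\<theta> by (simp add: field_simps)
  qed
  define \<gamma> where "\<gamma> = (1 - a) / 2"
  have \<gamma>: "0 < \<gamma>" using a by (simp add: \<gamma>_def)
  \<comment> \<open>\<open>D\<close> and \<open>E\<close> make the logarithms and the constants
    cancel in the balanced case. In \<open>C\<close>, the first summand serves the unbalanced case,
    \<open>D / \<theta> + E\<close> the nonnegativity of the exponent, and \<open>1\<close> gives
    positivity.\<close>
  define D where "D = b / (2 * a - 1)"
  define E where "E = (b' - 2 * a * D * ln \<epsilon>) / (2 * a - 1)"
  define C where "C = (b + D) / (\<theta> * \<gamma>) + D / \<theta> + E + 1"
  have D: "D \<ge> 0" "(2 * a - 1) * D = b"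
    using a b by (auto simp: D_def)
  have ln\<epsilon>: "ln \<epsilon> \<le> 0" using half \<epsilon> by (simp add: ln_le_zero_iff)
  have aD: "0 \<le> a * D * (- ln \<epsilon>)"
    using a D(1) ln\<epsilon> by (intro mult_nonneg_nonneg) auto
  have E: "E \<ge> 0" "(2 * a - 1) * E = b' - 2 * a * D * ln \<epsilon>"
    using a b aD by (auto simp: E_def)
  have b'E: "b' \<le> (2 * a - 1) * E" using E(2) aD by linarith
  have C1: "(b + D) / (\<theta> * \<gamma>) \<le> C" "D / \<theta> + E \<le> C" "0 < C"
    using b D E \<theta> \<gamma> by (auto simp: C_def add_nonneg_pos intro!: add_nonneg_nonneg)
  show thesis
  proof (rule that[of C D E])
    fix m :: real assume m: "1 \<le> m"
    then have one: "1 \<le> m powr \<theta>" using \<theta> by (simp add: ge_one_powr_ge_zero)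
    have "D * ln m \<le> D * (m powr \<theta> / \<theta>)"
      using m \<theta> D by (intro mult_left_mono ln_le_powr_div) auto
    moreover have "E * 1 \<le> E * m powr \<theta>"
      using one E by (intro mult_left_mono) auto
    moreover have "(D / \<theta> + E) * m powr \<theta> \<le> C * m powr \<theta>"
      using C1 by (intro mult_right_mono) auto
    ultimately show "0 \<le> C * m powr \<theta> - D * ln m - E"
      by (simp add: algebra_simps)
  next
    have *: "b * ln (i + j) + b' + a * ((C * i powr \<theta> - D * ln i - E) + (C * j powr \<theta> - D * ln j - E))
       \<le> C * (i + j) powr \<theta> - D * ln (i + j) - E" if i: "1 \<le> i" and ij: "i \<le> j" for i j
    proof -
      define m where "m = i + j"
      have m: "0 < m" "2 \<le> m" using i ij by (auto simp: m_def)
      show ?thesis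
      proof (cases "\<epsilon> * m \<le> i")
        case True
        \<comment> \<open>Balanced case: concavity and \<open>2 powr \<theta> = 2 * a\<close> bound
          the leading terms by \<open>C * m powr \<theta>\<close>, and both logarithms are at least
          \<open>ln (\<epsilon> * m)\<close>.\<close>
        have "i powr \<theta> + j powr \<theta> \<le> 2 * (m / 2) powr \<theta>"
          unfolding m_def using i ij \<theta> by (intro powr_add_le_two_half) auto
        also have "\<dots> = m powr \<theta> / a"
          using m \<theta> a by (simp add: powr_divide)
        finally have "a * C * (i powr \<theta> + j powr \<theta>) \<le> a * C * (m powr \<theta> / a)"
          using a C1 by (intro mult_left_mono) auto
        then have 1: "a * C * (i powr \<theta> + j powr \<theta>) \<le> C * m powr \<theta>"
          using a by simp
        have "ln (\<epsilon> * m) \<le> ln i" "ln (\<epsilon> * m) \<le> ln j"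
          using True ij i m \<epsilon> by (auto simp: ln_le_cancel_iff)
        then have "2 * (ln \<epsilon> + ln m) \<le> ln i + ln j"
          using \<epsilon> m by (simp add: ln_mult)
        then have "a * D * (2 * (ln \<epsilon> + ln m)) \<le> a * D * (ln i + ln j)"
          using a D by (intro mult_left_mono) auto
        then have "b * ln m + b' + a * C * (i powr \<theta> + j powr \<theta>) - a * D * (ln i + ln j) - 2 * a * E
           \<le> b * ln m + b' + C * m powr \<theta> - 2 * a * D * ln \<epsilon> - 2 * a * D * ln m - 2 * a * E"
          using 1 by (simp add: algebra_simps)
        also have "\<dots> = C * m powr \<theta> - D * ln m - E + (b - (2 * a - 1) * D) * ln m
            + (b' - 2 * a * D * ln \<epsilon> - (2 * a - 1) * E)"
          by (simp add: algebra_simps)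
        also have "\<dots> = C * m powr \<theta> - D * ln m - E"
          using D E by simp
        finally show ?thesis
          by (simp add: algebra_simps m_def)
      next
        case False
        \<comment> \<open>Unbalanced case: \<open>a + \<gamma> = 1 - \<gamma>\<close>, so a spare
          \<open>C * \<gamma> * m powr \<theta>\<close> remains to absorb
          \<open>(b + D) * ln m\<close>.\<close>
        then have "i powr \<theta> \<le> (\<epsilon> * m) powr \<theta>"
          using i \<theta> by (intro powr_mono2) auto
        also have "\<dots> = (1 - a) / (2 * a) * m powr \<theta>"
          using \<epsilon> m by (simp add: powr_mult \<epsilon>\<theta>)
        finally have "a * C * i powr \<theta> \<le> a * C * ((1 - a) / (2 * a) * m powr \<theta>)"
          using a C1 by (intro mult_left_mono) auto
        also have "\<dots> = C * \<gamma> * m powr \<theta>"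
          using a by (simp add: \<gamma>_def field_simps)
        finally have 1: "a * C * i powr \<theta> \<le> C * \<gamma> * m powr \<theta>" .
        have 2: "a * C * j powr \<theta> \<le> a * C * m powr \<theta>"
          using i ij \<theta> a C1 by (intro mult_left_mono powr_mono2) (auto simp: m_def)
        have "0 \<le> a * D * (ln i + ln j)"
          using i ij a D by (intro mult_nonneg_nonneg) auto
        moreover have "(b + D) * ln m \<le> (b + D) * (m powr \<theta> / \<theta>)"
          using m \<theta> b D by (intro mult_left_mono ln_le_powr_div) auto
        moreover have "(b + D) / (\<theta> * \<gamma>) * (\<gamma> * m powr \<theta>) \<le> C * (\<gamma> * m powr \<theta>)"
          using C1 \<gamma> by (intro mult_right_mono) auto
        moreover have "(b + D) / (\<theta> * \<gamma>) * (\<gamma> * m powr \<theta>) = (b + D) * (m powr \<theta> / \<theta>)"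
          using \<gamma> \<theta> by (simp add: field_simps)
        moreover have "C * \<gamma> * m powr \<theta> + a * C * m powr \<theta> = C * m powr \<theta> - C * \<gamma> * m powr \<theta>"
          by (simp add: \<gamma>_def field_simps)
        ultimately show ?thesis
          using 1 2 b'E unfolding m_def[symmetric] by (simp add: algebra_simps)
      qed
    qed
    fix i j :: real assume "1 \<le> i" "1 \<le> j"
    then show "b * ln (i + j) + b' + a * ((C * i powr \<theta> - D * ln i - E) + (C * j powr \<theta> - D * ln j - E))
       \<le> C * (i + j) powr \<theta> - D * ln (i + j) - E"
      using *[of i j] *[of j i] by (cases "i \<le> j") (auto simp: add.commute)
  qed (use C1 D E in auto)
qed

text \<open>With \<open>g n = exp (G (n + 1))\<close> the arguments \<open>k + 1\<close> and
  \<open>n - k\<close> add up to \<open>n + 1\<close>, which fits the split inequality. It is used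
  with \<open>b = p + 1\<close>, the additional power paying for the \<open>n\<close> summands, and
  with \<open>b' = ln B\<close>.\<close>

lemma growth_function:
  fixes a \<theta> B p :: real
  assumes a: "1/2 < a" "a < 1" and \<theta>: "0 < \<theta>" "\<theta> \<le> 1" "2 powr \<theta> = 2 * a" and B: "1 \<le> B" "0 \<le> p"
  obtains g :: "nat \<Rightarrow> real" and C :: real where "C > 0" "\<And>n. 1 \<le> g n" "\<And>n. g n \<le> exp (C * (real n + 1) powr \<theta>)"
    "\<And>n. 1 \<le> n \<Longrightarrow> B * real n powr p * (\<Sum>k<n. g k * g (n - 1 - k)) powr a \<le> g n"
proof -
  from split_inequality[OF a \<theta>, of "p + 1" "ln B"] B
  obtain C D E where C: "C > 0" "D \<ge> 0" "E \<ge> 0"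
    "\<And>m::real. 1 \<le> m \<Longrightarrow> 0 \<le> C * m powr \<theta> - D * ln m - E"
    "\<And>i j::real. 1 \<le> i \<Longrightarrow> 1 \<le> j \<Longrightarrow> (p + 1) * ln (i + j) + ln B + a * ((C * i powr \<theta> - D * ln i - E) + (C * j powr \<theta> - D * ln j - E))
       \<le> C * (i + j) powr \<theta> - D * ln (i + j) - E"
    by (auto simp: ln_ge_zero)
  define G where "G m = C * m powr \<theta> - D * ln m - E" for m :: real
  define g where "g n = exp (G (real n + 1))" for n :: nat
  show thesis
  proof (rule that[of C g])
    show "1 \<le> g n" for n using C(4)[of "real n + 1"] by (simp add: g_def G_def)
    show "g n \<le> exp (C * (real n + 1) powr \<theta>)" for n
    proof -
      have "0 \<le> D * ln (real n + 1)" using C(2) by (intro mult_nonneg_nonneg) auto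
      then have "G (real n + 1) \<le> C * (real n + 1) powr \<theta>"
        unfolding G_def using C(3) by linarith
      then show ?thesis by (simp add: g_def)
    qed
    fix n :: nat assume n: "1 \<le> n"
    define m where "m = real n + 1"
    have m: "n \<le> m" "0 < m" by (auto simp: m_def)
    \<comment> \<open>A bound for the exponent of every product in the sum, obtained by solving the
      split inequality for it.\<close>
    define U where "U = (G m - ln B - (p + 1) * ln m) / a"
    have "g k * g (n - 1 - k) \<le> exp U" if "k < n" for k
    proof -
      have "real (n - 1 - k) + 1 = real n - real k" using that by (simp add: of_nat_diff)
      then have "(p + 1) * ln m + ln B + a * (G (real k + 1) + G (real (n - 1 - k) + 1)) \<le> G m"
        using C(5)[of "real k + 1" "real n - real k"] that by (simp add: G_def m_def add.commute)
      then have "G (real k + 1) + G (real (n - 1 - k) + 1) \<le> U"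
        using a by (simp add: U_def field_simps)
      then show ?thesis by (simp add: g_def flip: exp_add)
    qed
    then have "(\<Sum>k<n. g k * g (n - 1 - k)) \<le> (\<Sum>k<n. exp U)"
      by (intro sum_mono) auto
    then have "(\<Sum>k<n. g k * g (n - 1 - k)) powr a \<le> (n * exp U) powr a"
      using a by (intro powr_mono2) (auto simp: g_def intro!: sum_nonneg)
    also have "\<dots> = n powr a * exp (G m - ln B - (p + 1) * ln m)"
      using a by (simp add: powr_mult U_def powr_def[of "exp _"])
    also have "\<dots> \<le> n powr 1 * exp (G m - ln B - (p + 1) * ln m)"
      using a n by (intro mult_right_mono powr_mono) auto
    finally have "B * n powr p * (\<Sum>k<n. g k * g (n - 1 - k)) powr a \<le>
       B * n powr p * (n powr 1 * exp (G m - ln B - (p + 1) * ln m))"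
      using B by (intro mult_left_mono) auto
    also have "\<dots> = n powr (p + 1) * (g n / m powr (p + 1))"
    proof -
      have "exp ((p + 1) * ln m) = m powr (p + 1)" "exp (G m) = g n"
        using m by (simp_all add: powr_def g_def m_def)
      then show ?thesis
        using B by (simp add: exp_diff powr_add[of "real n" p 1])
    qed
    also have "\<dots> \<le> m powr (p + 1) * (g n / m powr (p + 1))"
      using m B by (intro mult_right_mono powr_mono2) (auto simp: g_def)
    also have "\<dots> = g n" using m by simp
    finally show "B * real n powr p * (\<Sum>k<n. g k * g (n - 1 - k)) powr a \<le> g n" .
  qed (rule C)
qed

section \<open>Sums over the lattice\<close>

lemma lattice_box_eq: "lattice_box R = {x. linf_norm x \<le> R}"
proof -
  have "linf_norm x \<le> R \<longleftrightarrow> (\<forall>i. - R \<le> real_of_int (x $ i) \<and> real_of_int (x $ i) \<le> R)" for x :: "int ^ 'd"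
  proof -
    have "linf_norm x = Max (range (\<lambda>i. \<bar>real_of_int (x $ i)\<bar>))"
      unfolding linf_norm_def by (subst mono_Max_commute[where f=real_of_int]) (auto simp: mono_def image_image)
    then have "linf_norm x \<le> R \<longleftrightarrow> (\<forall>i. \<bar>real_of_int (x $ i)\<bar> \<le> R)"
      by (simp add: Max_le_iff)
    then show ?thesis by (auto simp: abs_le_iff minus_le_iff)
  qed
  then show ?thesis by (auto simp: lattice_box_def)
qed

lemma abs_component_le_linf_norm: "\<bar>real_of_int (x $ i)\<bar> \<le> linf_norm x"
proof -
  have "x \<in> lattice_box (linf_norm x)" by (simp add: lattice_box_eq)
  then have "- linf_norm x \<le> real_of_int (x $ i) \<and> real_of_int (x $ i) \<le> linf_norm x"
    by (simp add: lattice_box_def)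
  then show ?thesis by linarith
qed

lemma linf_norm_le_iff: "linf_norm x \<le> R \<longleftrightarrow> (\<forall>i. \<bar>real_of_int (x $ i)\<bar> \<le> R)"
  using lattice_box_eq[of R] by (auto simp: lattice_box_def set_eq_iff abs_le_iff minus_le_iff)

lemma linf_norm_nonneg: "0 \<le> linf_norm x"
  using abs_component_le_linf_norm[of x undefined] by linarith

lemma linf_norm_zero [simp]: "linf_norm 0 = 0"
  using linf_norm_nonneg[of 0] by (intro antisym) (auto simp: linf_norm_le_iff)

lemma linf_norm_triangle: "linf_norm (x + y) \<le> linf_norm x + linf_norm y"
  unfolding linf_norm_le_iff
proof
  fix i show "\<bar>real_of_int ((x + y) $ i)\<bar> \<le> linf_norm x + linf_norm y"
    using abs_component_le_linf_norm[of x i] abs_component_le_linf_norm[of y i] by auto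
qed

lemma linf_norm_minus [simp]: "linf_norm (- x) = linf_norm x"
  by (simp add: linf_norm_def)

lemma linf_norm_ge_1:
  assumes "x \<noteq> 0" shows "1 \<le> linf_norm x"
proof -
  obtain i where "x $ i \<noteq> 0" using assms by (auto simp: vec_eq_iff)
  then have "1 \<le> \<bar>real_of_int (x $ i)\<bar>" by linarith
  also have "\<dots> \<le> linf_norm x" by (rule abs_component_le_linf_norm)
  finally show ?thesis .
qed

lemma finite_lattice_box: "finite (lattice_box R :: (int ^ 'd) set)"
  and card_lattice_box: "0 \<le> R \<Longrightarrow> real (card (lattice_box R :: (int ^ 'd) set)) \<le> (2 * R + 1) ^ CARD('d)"
proof -
  define I where "I = {\<lceil>- R\<rceil>..\<lfloor>R\<rfloor>}"
  have *: "lattice_box R \<subseteq> (vec_lambda ` (PiE UNIV (\<lambda>_. I)) :: (int ^ 'd) set)"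
  proof
    fix x :: "int ^ 'd" assume "x \<in> lattice_box R"
    then have "vec_nth x \<in> PiE UNIV (\<lambda>_. I)"
      by (auto simp: lattice_box_def I_def ceiling_le_iff le_floor_iff)
    then show "x \<in> vec_lambda ` (PiE UNIV (\<lambda>_. I))"
      by (metis imageI vec_nth_inverse)
  qed
  have fin: "finite (PiE UNIV (\<lambda>_. I) :: ('d \<Rightarrow> int) set)" by (intro finite_PiE) (auto simp: I_def)
  then show "finite (lattice_box R :: (int ^ 'd) set)"
    using * finite_subset by blast
  assume R: "0 \<le> R"
  have "card (lattice_box R :: (int ^ 'd) set) \<le> card (PiE UNIV (\<lambda>_. I) :: ('d \<Rightarrow> int) set)"
    using * fin by (meson card_image_le card_mono finite_imageI order_trans)
  also have "\<dots> = card I ^ CARD('d)" by (simp add: card_PiE)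
  finally have "real (card (lattice_box R :: (int ^ 'd) set)) \<le> real (card I) ^ CARD('d)"
    by (metis of_nat_le_iff of_nat_power)
  also have "real (card I) \<le> 2 * R + 1"
    unfolding I_def using R by (simp add: ceiling_minus)
  then have "real (card I) ^ CARD('d) \<le> (2 * R + 1) ^ CARD('d)" by (intro power_mono) auto
  finally show "real (card (lattice_box R :: (int ^ 'd) set)) \<le> (2 * R + 1) ^ CARD('d)" .
qed

section \<open>Power sums by dyadic shells and truncation\<close>

lemma dyadic_scale:
  fixes r R :: real assumes "0 < R" "R < r"
  obtains j :: nat where "2 ^ j * R < r" "r \<le> 2 ^ Suc j * R"
proof -
  obtain n where n: "r / R < 2 ^ n" using real_arch_pow[of 2 "r / R"] by auto
  define k where "k = (LEAST k. r \<le> 2 ^ k * R)"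
  have k: "r \<le> 2 ^ k * R" unfolding k_def
    by (rule LeastI[of _ n]) (use n assms in \<open>simp add: field_simps\<close>)
  have "k \<noteq> 0" using k assms by (auto intro: ccontr)
  then have "\<not> r \<le> 2 ^ (k - 1) * R" using not_less_Least[of "k - 1" "\<lambda>k. r \<le> 2 ^ k * R"] by (simp add: k_def)
  with k \<open>k \<noteq> 0\<close> show thesis by (intro that[of "k - 1"]) auto
qed

text \<open>The shell between \<open>S = 2 ^ j * R\<close> and \<open>2 * S\<close> has at most
  \<open>(5 * S) ^ d\<close> points, each contributing at most
  \<open>S powr - (d + \<alpha>)\<close>. Its total is of order \<open>S powr - \<alpha>\<close>,
  and these form a geometric series in \<open>j\<close>.\<close>

lemma lattice_tail_sum:
  fixes \<alpha> :: real
  assumes "0 < \<alpha>"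
  obtains C where "C > 0" "\<And>R. 1 \<le> R \<Longrightarrow>
    (\<integral>\<^sup>+x. (if R < linf_norm x then ennreal (linf_norm x powr - (real CARD('d) + \<alpha>)) else 0) \<partial>count_space (UNIV :: (int ^ 'd) set))
      \<le> ennreal (C * R powr - \<alpha>)"
proof -
  define q where "q = 2 powr - \<alpha>"
  have q: "0 < q" "q < 1" using assms by (auto simp: q_def powr_less_one)
  define C where "C = 5 ^ CARD('d) / (1 - q)"
  show thesis
  proof (rule that[of C])
    show "C > 0" using q by (simp add: C_def)
    fix R :: real assume R: "1 \<le> R"
    define f where "f x = (if R < linf_norm x then ennreal (linf_norm x powr - (real CARD('d) + \<alpha>)) else 0)" for x :: "int ^ 'd"
    define h where "h j x = ennreal ((2 ^ j * R) powr - (real CARD('d) + \<alpha>)) * indicator (lattice_box (2 ^ Suc j * R)) x"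
      for j and x :: "int ^ 'd"
    have "f x \<le> (\<Sum>j. h j x)" for x
    proof (cases "R < linf_norm x")
      case True
      then obtain j where j: "2 ^ j * R < linf_norm x" "linf_norm x \<le> 2 ^ Suc j * R"
        using dyadic_scale[of R "linf_norm x"] R by auto
      then have "f x \<le> h j x"
        using R assms by (auto simp: f_def h_def lattice_box_eq intro!: ennreal_leI powr_mono2')
      also have "\<dots> \<le> (\<Sum>j. h j x)"
        using sum_le_suminf[of "\<lambda>j. h j x" "{j}"] by simp
      finally show ?thesis .
    qed (simp add: f_def)
    then have "(\<integral>\<^sup>+x. f x \<partial>count_space UNIV) \<le> (\<integral>\<^sup>+x. (\<Sum>j. h j x) \<partial>count_space UNIV)"
      by (intro nn_integral_mono) auto
    also have "\<dots> = (\<Sum>j. \<integral>\<^sup>+x. h j x \<partial>count_space UNIV)"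
      by (rule nn_integral_suminf) auto
    also have "\<dots> \<le> (\<Sum>j. ennreal (5 ^ CARD('d) * R powr - \<alpha> * q ^ j))"
    proof (intro suminf_le)
      fix j :: nat
      define S where "S = 2 ^ j * R"
      have "1 \<le> (2::real) ^ j" by simp
      then have S: "1 \<le> S" unfolding S_def using R
        by (metis mult_mono' mult_1 zero_le_one)
      have "(\<integral>\<^sup>+x. h j x \<partial>count_space UNIV) = ennreal (S powr - (real CARD('d) + \<alpha>)) * ennreal (card (lattice_box (2 * S) :: (int ^ 'd) set))"
        unfolding h_def by (subst nn_integral_cmult_indicator)
          (auto simp: S_def finite_lattice_box emeasure_count_space_finite mult.assoc ennreal_of_nat_eq_real_of_nat)
      also have "\<dots> = ennreal (S powr - (real CARD('d) + \<alpha>) * card (lattice_box (2 * S) :: (int ^ 'd) set))"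
        by (simp add: ennreal_mult)
      also have "\<dots> \<le> ennreal (S powr - (real CARD('d) + \<alpha>) * (5 * S) ^ CARD('d))"
      proof (intro ennreal_leI mult_left_mono)
        have "real (card (lattice_box (2 * S) :: (int ^ 'd) set)) \<le> (2 * (2 * S) + 1) ^ CARD('d)"
          using S by (intro card_lattice_box) auto
        also have "\<dots> \<le> (5 * S) ^ CARD('d)" using S by (intro power_mono) auto
        finally show "real (card (lattice_box (2 * S) :: (int ^ 'd) set)) \<le> (5 * S) ^ CARD('d)" .
      qed simp
      also have "S powr - (real CARD('d) + \<alpha>) * (5 * S) ^ CARD('d) = 5 ^ CARD('d) * S powr - \<alpha>"
      proof -
        have "S powr - (real CARD('d) + \<alpha>) = S powr - \<alpha> * S powr - real CARD('d)"
          unfolding powr_add[symmetric] by (simp add: algebra_simps)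
        also have "S powr - real CARD('d) = inverse (S ^ CARD('d))"
          using S by (simp add: powr_minus powr_realpow)
        finally show ?thesis using S by (simp add: power_mult_distrib)
      qed
      also have "S powr - \<alpha> = R powr - \<alpha> * q ^ j"
      proof -
        have "(2 ^ j) powr - \<alpha> = q ^ j"
          unfolding q_def by (simp add: powr_powr mult.commute flip: powr_realpow)
        then show ?thesis using R by (simp add: S_def powr_mult)
      qed
      finally show "(\<integral>\<^sup>+x. h j x \<partial>count_space UNIV) \<le> ennreal (5 ^ CARD('d) * R powr - \<alpha> * q ^ j)"
        by (simp add: mult.assoc)
    qed auto
    also have "\<dots> = ennreal (\<Sum>j. 5 ^ CARD('d) * R powr - \<alpha> * q ^ j)"
      using q by (intro suminf_ennreal2 summable_mult) (auto intro!: summable_geometric)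
    also have "(\<Sum>j. 5 ^ CARD('d) * R powr - \<alpha> * q ^ j) = C * R powr - \<alpha>"
      using q by (simp add: suminf_mult suminf_geometric summable_geometric C_def)
    finally show "(\<integral>\<^sup>+x. (if R < linf_norm x then ennreal (linf_norm x powr - (real CARD('d) + \<alpha>)) else 0) \<partial>count_space (UNIV :: (int ^ 'd) set))
      \<le> ennreal (C * R powr - \<alpha>)"
      by (simp add: f_def)
  qed
qed

text \<open>Cut at the radius \<open>R = T powr (1 / s)\<close>, \<open>s = d + \<alpha>\<close>,
  where the two bounds on \<open>f\<close> cross. The box contributes order \<open>R ^ d\<close>,
  the tail order \<open>T * R powr - \<alpha>\<close>, and both equal
  \<open>T powr (d / s)\<close>.\<close>

lemma lattice_truncated_sum:
  fixes \<alpha> :: real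
  assumes "0 < \<alpha>"
  obtains C where "C \<ge> 1" "\<And>T (f :: int ^ 'd \<Rightarrow> ennreal). 1 \<le> T \<Longrightarrow> (\<And>x. f x \<le> 1) \<Longrightarrow>
    (\<And>x. x \<noteq> 0 \<Longrightarrow> f x \<le> ennreal (T * linf_norm x powr - (real CARD('d) + \<alpha>))) \<Longrightarrow>
    (\<integral>\<^sup>+x. f x \<partial>count_space UNIV) \<le> ennreal (C * T powr (CARD('d) / (CARD('d) + \<alpha>)))"
proof -
  obtain C where C: "C > 0" "\<And>R. 1 \<le> R \<Longrightarrow>
    (\<integral>\<^sup>+x. (if R < linf_norm x then ennreal (linf_norm x powr - (real CARD('d) + \<alpha>)) else 0) \<partial>count_space (UNIV :: (int ^ 'd) set))
      \<le> ennreal (C * R powr - \<alpha>)"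
    using lattice_tail_sum[OF assms] by blast
  show thesis
  proof (rule that[of "3 ^ CARD('d) + C"])
    show "1 \<le> 3 ^ CARD('d) + C" using C(1) by (simp add: add_increasing2)
    fix T :: real and f :: "int ^ 'd \<Rightarrow> ennreal"
    assume T: "1 \<le> T" and f: "\<And>x. f x \<le> 1"
      "\<And>x. x \<noteq> 0 \<Longrightarrow> f x \<le> ennreal (T * linf_norm x powr - (real CARD('d) + \<alpha>))"
    define s where "s = CARD('d) + \<alpha>"
    define R where "R = T powr (1 / s)"
    have s: "0 < s" "CARD('d) < s" using assms by (auto simp: s_def add_pos_pos)
    have R: "1 \<le> R" using T s by (simp add: R_def ge_one_powr_ge_zero)
    define h where "h x = (if R < linf_norm x then ennreal (linf_norm x powr - s) else 0)" for x :: "int ^ 'd"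
    have "f x \<le> indicator (lattice_box R) x + ennreal T * h x" for x
    proof (cases "R < linf_norm x")
      case True
      then have "x \<noteq> 0" using R by auto
      from f(2)[OF this] True show ?thesis
        using T by (simp add: lattice_box_eq h_def s_def ennreal_mult)
    next
      case False
      then show ?thesis using f(1)[of x] by (simp add: lattice_box_eq h_def)
    qed
    then have "(\<integral>\<^sup>+x. f x \<partial>count_space UNIV) \<le> (\<integral>\<^sup>+x. indicator (lattice_box R) x + ennreal T * h x \<partial>count_space UNIV)"
      by (intro nn_integral_mono) auto
    also have "\<dots> = ennreal (card (lattice_box R :: (int ^ 'd) set)) + ennreal T * (\<integral>\<^sup>+x. h x \<partial>count_space UNIV)"
      by (subst nn_integral_add) (auto simp: nn_integral_cmult finite_lattice_box ennreal_of_nat_eq_real_of_nat)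
    also have "\<dots> \<le> ennreal ((3 * R) ^ CARD('d)) + ennreal T * ennreal (C * R powr - \<alpha>)"
    proof (intro add_mono mult_left_mono ennreal_leI)
      have "real (card (lattice_box R :: (int ^ 'd) set)) \<le> (2 * R + 1) ^ CARD('d)"
        using R by (intro card_lattice_box) auto
      also have "\<dots> \<le> (3 * R) ^ CARD('d)" using R by (intro power_mono) auto
      finally show "real (card (lattice_box R :: (int ^ 'd) set)) \<le> (3 * R) ^ CARD('d)" .
      show "(\<integral>\<^sup>+x. h x \<partial>count_space UNIV) \<le> ennreal (C * R powr - \<alpha>)"
        unfolding h_def s_def using C(2)[OF R] by simp
    qed simp
    also have "\<dots> = ennreal ((3 * R) ^ CARD('d) + T * (C * R powr - \<alpha>))"
      using R C T by (simp add: ennreal_mult)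
    also have "(3 * R) ^ CARD('d) + T * (C * R powr - \<alpha>) = (3 ^ CARD('d) + C) * T powr (CARD('d) / s)"
    proof -
      have "R ^ CARD('d) = T powr (CARD('d) / s)"
        using T by (simp add: R_def powr_power)
      moreover have "T * R powr - \<alpha> = T powr (CARD('d) / s)"
      proof -
        have "T * R powr - \<alpha> = T powr (1 + - \<alpha> / s)"
          using T unfolding powr_add by (simp add: R_def powr_powr)
        also have "1 + - \<alpha> / s = CARD('d) / s" using s by (simp add: field_simps) (simp add: s_def)
        finally show ?thesis .
      qed
      ultimately show ?thesis by (simp add: power_mult_distrib algebra_simps)
    qed
    finally show "(\<integral>\<^sup>+x. f x \<partial>count_space UNIV) \<le> ennreal ((3 ^ CARD('d) + C) * T powr (CARD('d) / (CARD('d) + \<alpha>)))"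
      by (simp add: s_def)
  qed
qed

section \<open>Long-range directed graphs\<close>

text \<open>By Tonelli the sum of the connection probabilities is the expected size of the ball, and
  a variable of finite expectation is almost surely finite.\<close>

lemma (in random_digraph) AE_finite_gball:
  assumes "(\<integral>\<^sup>+y. reach_prob n x y \<partial>count_space UNIV) < \<infinity>"
  shows "AE \<omega> in M. finite (gball (E \<omega>) UNIV n x)"
proof -
  define f where "f y \<omega> = (indicator (gball (E \<omega>) UNIV n x) y :: ennreal)" for y \<omega>
  have f [measurable]: "f y \<in> borel_measurable M" for y
    unfolding f_def indicator_def by measurable
  \<comment> \<open>Joint measurability in outcome and vertex holds because there are only countably
    many vertices.\<close>
  have pair: "(\<lambda>p. f (snd p) (fst p)) \<in> borel_measurable (M \<Otimes>\<^sub>M count_space UNIV)"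
    by (rule measurable_compose_countable'[where f="\<lambda>y p. f y (fst p)" and g=snd and I=UNIV]) auto
  have [measurable]: "(\<lambda>\<omega>. \<integral>\<^sup>+y. f y \<omega> \<partial>count_space UNIV) \<in> borel_measurable M"
    using sigma_finite_measure.borel_measurable_nn_integral[OF sigma_finite_measure_count_space, of "\<lambda>\<omega> y. f y \<omega>"] pair
    by (simp add: case_prod_beta')
  have "(\<integral>\<^sup>+\<omega>. \<integral>\<^sup>+y. f y \<omega> \<partial>count_space UNIV \<partial>M) = (\<integral>\<^sup>+y. \<integral>\<^sup>+\<omega>. f y \<omega> \<partial>M \<partial>count_space UNIV)"
    by (rule nn_integral_count_space_nn_integral) auto
  also have "\<dots> = (\<integral>\<^sup>+y. reach_prob n x y \<partial>count_space UNIV)"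
  proof (rule nn_integral_cong)
    fix y
    have "(\<integral>\<^sup>+\<omega>. f y \<omega> \<partial>M) = (\<integral>\<^sup>+\<omega>. indicator {\<omega>\<in>space M. y \<in> gball (E \<omega>) UNIV n x} \<omega> \<partial>M)"
      by (rule nn_integral_cong) (auto simp: f_def indicator_def)
    then show "(\<integral>\<^sup>+\<omega>. f y \<omega> \<partial>M) = reach_prob n x y" by simp
  qed
  finally have "AE \<omega> in M. (\<integral>\<^sup>+y. f y \<omega> \<partial>count_space UNIV) \<noteq> \<infinity>"
    using assms by (intro nn_integral_PInf_AE) auto
  then show ?thesis
  proof eventually_elim
    case (elim \<omega>)
    then show ?case
      using emeasure_count_space_infinite[of "gball (E \<omega>) UNIV n x" UNIV]
      unfolding f_def by (auto simp: emeasure_count_space infinity_ennreal_def split: if_splits)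
  qed
qed

lemma (in random_digraph) AE_finite_gball_less:
  assumes "\<And>j. j < n \<Longrightarrow> (\<integral>\<^sup>+y. reach_prob j x y \<partial>count_space UNIV) < \<infinity>"
  shows "AE \<omega> in M. finite (gball_less (E \<omega>) UNIV n x)"
proof -
  have "AE \<omega> in M. \<forall>j\<in>{..<n}. finite (gball (E \<omega>) UNIV j x)"
    using assms by (intro AE_finite_allI AE_finite_gball) auto
  then show ?thesis
    by eventually_elim (auto simp: gball_less_def)
qed

text \<open>The normalization \<open>1 \<le> K\<close> keeps the factor in front of the power of the
  distance at least 1, as the truncated sum requires.\<close>

locale long_range_digraph = random_digraph M E \<G>
  for M :: "'a measure" and E :: "'a \<Rightarrow> int ^ 'd \<Rightarrow> int ^ 'd \<Rightarrow> bool" and \<G> +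
  fixes \<alpha> K :: real
  assumes \<alpha>: "0 < \<alpha>" "\<alpha> < CARD('d)"
    and K: "1 \<le> K"
    and edge_prob_le: "\<And>u w. u \<noteq> w \<Longrightarrow> edge_prob u w \<le> ennreal (K * linf_norm (u - w) powr - (CARD('d) + \<alpha>))"
begin

text \<open>An edge of length at least \<open>|x - y| / n\<close> has probability at most
  \<open>K * n powr s * |x - y| powr - s\<close>, \<open>s = d + \<alpha>\<close>. The recursion
  sums over the endpoint of the initial segment and over the starting point of the final one, so
  both row and column sums must be controlled.\<close>

lemma reach_prob_step:
  fixes g :: "nat \<Rightarrow> real"
  assumes g: "\<And>k. k < n \<Longrightarrow> 1 \<le> g k"
    and row: "\<And>k x. k < n \<Longrightarrow> (\<integral>\<^sup>+y. reach_prob k x y \<partial>count_space UNIV) \<le> ennreal (g k)"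
    and col: "\<And>k y. k < n \<Longrightarrow> (\<integral>\<^sup>+x. reach_prob k x y \<partial>count_space UNIV) \<le> ennreal (g k)"
    and xy: "x \<noteq> y"
  shows "reach_prob n x y \<le> ennreal ((K * real n powr (CARD('d) + \<alpha>) * (\<Sum>k<n. g k * g (n - 1 - k))) *
    linf_norm (x - y) powr - (CARD('d) + \<alpha>))"
proof (cases "n = 0")
  case True
  with xy show ?thesis by simp
next
  case n: False
  define s where "s = CARD('d) + \<alpha>"
  define len where "len u w = linf_norm (u - w)" for u w :: "int ^ 'd"
  define e where "e = K * (len x y / n) powr - s"
  have s: "0 < s" using \<alpha> by (simp add: s_def add_pos_pos)
  have len: "1 \<le> len x y" unfolding len_def using xy by (intro linf_norm_ge_1) auto
  have e0: "0 \<le> e" using K by (simp add: e_def)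
  have "reach_prob n x y \<le> ennreal e * (\<Sum>k<n. (\<integral>\<^sup>+u. reach_prob k x u \<partial>count_space UNIV) *
      (\<integral>\<^sup>+w. reach_prob (n - 1 - k) w y \<partial>count_space UNIV))"
  proof (rule reach_prob_recursion[where len=len])
    show "len a a = 0" "0 \<le> len a b" for a b
      by (simp_all add: len_def linf_norm_nonneg)
    show "len a c \<le> len a b + len b c" for a b c
      using linf_norm_triangle[of "a - b" "b - c"] by (simp add: len_def)
    show "AE \<omega> in M. finite (gball_less (E \<omega>) UNIV k x)" if "k < n" for k
    proof (rule AE_finite_gball_less)
      fix j assume "j < k"
      with row[of j x] that show "(\<integral>\<^sup>+y. reach_prob j x y \<partial>count_space UNIV) < \<infinity>"
        by (auto simp: top_unique less_top[symmetric])
    qed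
    fix u w assume uw: "len x y / n \<le> len u w"
    show "edge_prob u w \<le> ennreal e"
    proof -
      have pos: "0 < len x y / n" using len n by simp
      then have "u \<noteq> w" using uw by (auto simp: len_def)
      then have "edge_prob u w \<le> ennreal (K * len u w powr - s)"
        using edge_prob_le by (simp add: len_def s_def)
      also have "\<dots> \<le> ennreal e"
        unfolding e_def using pos uw s K by (intro ennreal_leI mult_left_mono powr_mono2') auto
      finally show ?thesis .
    qed
  qed fact
  also have "\<dots> \<le> ennreal e * (\<Sum>k<n. ennreal (g k) * ennreal (g (n - 1 - k)))"
    by (intro mult_left_mono sum_mono mult_mono row col) auto
  also have "(\<Sum>k<n. ennreal (g k) * ennreal (g (n - 1 - k))) = (\<Sum>k<n. ennreal (g k * g (n - 1 - k)))"
  proof (intro sum.cong refl ennreal_mult[symmetric])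
    fix k assume "k \<in> {..<n}"
    then show "0 \<le> g k" "0 \<le> g (n - 1 - k)" using g[of k] g[of "n - 1 - k"] by force+
  qed
  also have "\<dots> = ennreal (\<Sum>k<n. g k * g (n - 1 - k))"
  proof (rule sum_ennreal)
    fix k assume "k \<in> {..<n}"
    then have "0 \<le> g k" "0 \<le> g (n - 1 - k)" using g[of k] g[of "n - 1 - k"] by force+
    then show "0 \<le> g k * g (n - 1 - k)" by simp
  qed
  also have "ennreal e * \<dots> = ennreal (e * (\<Sum>k<n. g k * g (n - 1 - k)))"
    using e0 by (simp add: ennreal_mult')
  also have "e = K * n powr s * len x y powr - s"
    using len by (simp add: e_def powr_divide powr_minus field_simps)
  finally show ?thesis
    by (simp add: s_def len_def mult_ac)
qed

text \<open>Strong induction bounds the row and column sums at radius \<open>n\<close> by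
  \<open>g n\<close>: the pointwise bound with factor \<open>T n\<close>, truncated at 1, sums to at
  most \<open>C0 * T n powr a\<close>, and \<open>g\<close> is built to dominate this. The pointwise
  claim then follows by inverting the power \<open>a = d / s\<close>.\<close>

lemma reach_prob_growth:
  fixes \<theta> :: real
  assumes \<theta>: "0 < \<theta>" "2 powr \<theta> = 2 * CARD('d) / (CARD('d) + \<alpha>)"
  obtains C where "C > 0" "\<And>n x y. x \<noteq> y \<Longrightarrow>
    reach_prob n x y \<le> ennreal (exp (C * (real n + 1) powr \<theta>) * linf_norm (x - y) powr - (CARD('d) + \<alpha>))"
proof -
  define d where "d = real CARD('d)"
  define s where "s = d + \<alpha>"
  define a where "a = d / s"
  have d: "0 < d" "1 \<le> d" by (auto simp: d_def Suc_leI)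
  have s: "0 < s" "d < s" "s < 2 * d" using \<alpha> d by (auto simp: s_def d_def)
  have a: "1/2 < a" "a < 1" using s by (auto simp: a_def field_simps)
  have \<theta>a: "2 powr \<theta> = 2 * a" using \<theta> by (simp add: a_def s_def d_def)
  have "\<theta> \<le> 1"
  proof (rule ccontr)
    assume "\<not> \<theta> \<le> 1"
    then have "(2::real) powr 1 \<le> 2 powr \<theta>" by (intro powr_mono) auto
    with \<theta>a a show False by simp
  qed
  obtain C0 where C0: "1 \<le> C0" "\<And>T (f :: int ^ 'd \<Rightarrow> ennreal). 1 \<le> T \<Longrightarrow> (\<And>x. f x \<le> 1) \<Longrightarrow>
    (\<And>x. x \<noteq> 0 \<Longrightarrow> f x \<le> ennreal (T * linf_norm x powr - (real CARD('d) + \<alpha>))) \<Longrightarrow>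
    (\<integral>\<^sup>+x. f x \<partial>count_space UNIV) \<le> ennreal (C0 * T powr (CARD('d) / (CARD('d) + \<alpha>)))"
    using lattice_truncated_sum[OF \<alpha>(1)] by blast
  have B: "1 \<le> C0 * K powr a"
    using mult_mono[OF C0(1), of 1 "K powr a"] C0(1) K a by (simp add: ge_one_powr_ge_zero)
  \<comment> \<open>The power \<open>d\<close> of \<open>n\<close> arises as
    \<open>(n powr s) powr a\<close>, since \<open>s * a = d\<close>.\<close>
  obtain C g where g: "C > 0" "\<And>n. 1 \<le> g n" "\<And>n. g n \<le> exp (C * (real n + 1) powr \<theta>)"
    "\<And>n. 1 \<le> n \<Longrightarrow> C0 * K powr a * real n powr d * (\<Sum>k<n. g k * g (n - 1 - k)) powr a \<le> g n"
    by (rule growth_function[OF a \<theta>(1) \<open>\<theta> \<le> 1\<close> \<theta>a B less_imp_le[OF d(1)]], rule that)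
  define T where "T n = K * real n powr s * (\<Sum>k<n. g k * g (n - 1 - k))" for n
  have sum_ge: "1 \<le> (\<Sum>k<n. g k * g (n - 1 - k))" if "1 \<le> n" for n
  proof -
    have "1 * 1 \<le> g k * g (n - 1 - k)" for k
      using g(2)[of k] g(2)[of "n - 1 - k"] by (intro mult_mono) auto
    then have "(\<Sum>k<n. 1) \<le> (\<Sum>k<n. g k * g (n - 1 - k))"
      by (intro sum_mono) auto
    with that show ?thesis by simp
  qed
  have T1: "1 \<le> T n" if "1 \<le> n" for n
  proof -
    have "1 \<le> real n powr s" using that s by (intro ge_one_powr_ge_zero) auto
    with K have "1 * 1 \<le> K * real n powr s" by (intro mult_mono) auto
    then have "1 * 1 \<le> T n" unfolding T_def using sum_ge[OF that] by (intro mult_mono) auto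
    then show ?thesis by simp
  qed
  have Tg: "C0 * T n powr a \<le> g n" if "1 \<le> n" for n
  proof -
    have "T n powr a = K powr a * real n powr d * (\<Sum>k<n. g k * g (n - 1 - k)) powr a"
      unfolding T_def using K s d sum_ge[OF that] by (simp add: powr_mult powr_powr a_def)
    then show ?thesis using g(4)[OF that] by (simp add: mult.assoc)
  qed
  have sums: "(\<forall>x. (\<integral>\<^sup>+y. reach_prob n x y \<partial>count_space UNIV) \<le> ennreal (g n)) \<and>
       (\<forall>y. (\<integral>\<^sup>+x. reach_prob n x y \<partial>count_space UNIV) \<le> ennreal (g n))" for n
  proof (induction n rule: less_induct)
    case (less n)
    show ?case
    proof (cases "n = 0")
      case True
      have eq: "reach_prob 0 x y = indicator {x} y" "reach_prob 0 x y = indicator {y} x" for x y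
        by (auto simp: emeasure_space_1 indicator_def)
      have "(\<integral>\<^sup>+y. reach_prob 0 x y \<partial>count_space UNIV) = 1" for x
        unfolding eq(1) by simp
      moreover have "(\<integral>\<^sup>+x. reach_prob 0 x y \<partial>count_space UNIV) = 1" for y
        unfolding eq(2) by simp
      ultimately show ?thesis
        unfolding True using g(2)[of 0] by simp
    next
      case False
      then have n: "1 \<le> n" by simp
      have step: "reach_prob n x y \<le> ennreal (T n * linf_norm (x - y) powr - s)" if "x \<noteq> y" for x y
        unfolding T_def s_def d_def
        by (rule reach_prob_step[OF g(2) _ _ that]) (use less in auto)
      \<comment> \<open>Recentring the sums at \<open>v\<close> brings them to the form of the
        truncated sum, since the pointwise bounds depend only on differences.\<close>
      have translate: "(\<integral>\<^sup>+z. f (v + z) \<partial>count_space UNIV) = (\<integral>\<^sup>+z. f z \<partial>count_space UNIV)" for f :: "int ^ 'd \<Rightarrow> ennreal" and v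
        by (rule nn_integral_bij_count_space[of "(+) v"]) (auto intro!: bij_betwI[where g="\<lambda>z. z - v"])
      have bound: "(\<integral>\<^sup>+z. f (v + z) \<partial>count_space UNIV) \<le> ennreal (g n)"
        if "\<And>z. f z \<le> 1" "\<And>z. z \<noteq> v \<Longrightarrow> f z \<le> ennreal (T n * linf_norm (v - z) powr - s)" for f :: "int ^ 'd \<Rightarrow> ennreal" and v
      proof -
        have "(\<integral>\<^sup>+z. f (v + z) \<partial>count_space UNIV) \<le> ennreal (C0 * T n powr a)"
          unfolding a_def s_def d_def
        proof (rule C0(2)[OF T1[OF n]])
          fix z :: "int ^ 'd" assume "z \<noteq> 0"
          then show "f (v + z) \<le> ennreal (T n * linf_norm z powr - (real CARD('d) + \<alpha>))"
            using that(2)[of "v + z"] by (simp add: s_def d_def)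
        qed (rule that(1))
        also have "\<dots> \<le> ennreal (g n)" by (intro ennreal_leI Tg n)
        finally show ?thesis .
      qed
      show ?thesis
      proof safe
        fix x
        have "(\<integral>\<^sup>+z. reach_prob n x (x + z) \<partial>count_space UNIV) \<le> ennreal (g n)"
          by (rule bound) (use step in \<open>auto intro: emeasure_le_1\<close>)
        then show "(\<integral>\<^sup>+y. reach_prob n x y \<partial>count_space UNIV) \<le> ennreal (g n)"
          unfolding translate[of "\<lambda>y. reach_prob n x y"] .
      next
        fix y
        have "(\<integral>\<^sup>+z. reach_prob n (y + z) y \<partial>count_space UNIV) \<le> ennreal (g n)"
        proof (rule bound[of "\<lambda>x. reach_prob n x y"])
          fix x assume "x \<noteq> y"
          moreover have "linf_norm (x - y) = linf_norm (y - x)"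
            using linf_norm_minus[of "x - y"] by simp
          ultimately show "reach_prob n x y \<le> ennreal (T n * linf_norm (y - x) powr - s)"
            using step[of x y] by simp
        qed (rule emeasure_le_1)
        then show "(\<integral>\<^sup>+x. reach_prob n x y \<partial>count_space UNIV) \<le> ennreal (g n)"
          unfolding translate[of "\<lambda>x. reach_prob n x y"] .
      qed
    qed
  qed
  show thesis
  proof (rule that[of "C / a"])
    show "0 < C / a" using g(1) a by simp
    fix n :: nat and x y :: "int ^ 'd" assume xy: "x \<noteq> y"
    show "reach_prob n x y \<le> ennreal (exp (C / a * (real n + 1) powr \<theta>) * linf_norm (x - y) powr - (CARD('d) + \<alpha>))"
    proof (cases "n = 0")
      case True
      with xy show ?thesis by simp
    next
      case False
      then have n: "1 \<le> n" by simp
      \<comment> \<open>\<open>C0 \<ge> 1\<close> may be dropped, and the power \<open>1 / a\<close>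
        turns the constant \<open>C\<close> into \<open>C / a\<close>.\<close>
      have "1 * T n powr a \<le> C0 * T n powr a"
        using C0(1) by (intro mult_right_mono) auto
      also have "\<dots> \<le> exp (C * (real n + 1) powr \<theta>)"
        using Tg[OF n] g(3)[of n] by simp
      finally have "(T n powr a) powr (1 / a) \<le> exp (C * (real n + 1) powr \<theta>) powr (1 / a)"
        using a by (intro powr_mono2) auto
      then have "T n \<le> exp (C / a * (real n + 1) powr \<theta>)"
        using a T1[OF n] by (simp add: powr_powr powr_def[of "exp _"])
      moreover have "reach_prob n x y \<le> ennreal (T n * linf_norm (x - y) powr - s)"
        unfolding T_def s_def d_def
        by (rule reach_prob_step[OF g(2) _ _ xy]) (use sums in auto)
      ultimately show ?thesis
        unfolding s_def d_def by (elim order_trans) (intro ennreal_leI mult_right_mono, auto)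
    qed
  qed
qed

text \<open>The expected number of vertices of the ball of radius \<open>n\<close> at distance
  beyond \<open>R n\<close> is at most
  \<open>C2 * exp (C1 * (n + 1) powr \<theta>) * R n powr - \<alpha>\<close>. For suitable
  \<open>C\<close> this is summable, and Borel-Cantelli applies.\<close>

lemma AE_gball_subset_box:
  fixes \<theta> :: real
  assumes \<theta>: "0 < \<theta>" "2 powr \<theta> = 2 * CARD('d) / (CARD('d) + \<alpha>)"
  obtains C where "C > 0"
    "AE \<omega> in M. \<forall>\<^sub>F n in sequentially. gball (E \<omega>) UNIV n 0 \<subseteq> lattice_box (exp (C * (real n + 1) powr \<theta>))"
proof -
  obtain C1 where C1: "C1 > 0" "\<And>n x y. x \<noteq> y \<Longrightarrow>
    reach_prob n x y \<le> ennreal (exp (C1 * (real n + 1) powr \<theta>) * linf_norm (x - y) powr - (CARD('d) + \<alpha>))"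
    using reach_prob_growth[OF \<theta>] by blast
  obtain C2 where C2: "C2 > 0" "\<And>R. 1 \<le> R \<Longrightarrow>
    (\<integral>\<^sup>+x. (if R < linf_norm x then ennreal (linf_norm x powr - (real CARD('d) + \<alpha>)) else 0) \<partial>count_space (UNIV :: (int ^ 'd) set))
      \<le> ennreal (C2 * R powr - \<alpha>)"
    using lattice_tail_sum[OF \<alpha>(1)] by blast
  \<comment> \<open>Then \<open>\<alpha> * C = C1 + 2 / \<theta>\<close>: the first part cancels the
    growth, and the second leaves \<open>exp (- 2 * (n + 1) powr \<theta> / \<theta>)\<close>, which
    is at most \<open>1 / (n + 1) ^ 2\<close>.\<close>
  define C where "C = (C1 + 2 / \<theta>) / \<alpha>"
  have C: "C > 0" using C1 \<theta> \<alpha> by (simp add: C_def add_pos_pos)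
  define R where "R n = exp (C * (real n + 1) powr \<theta>)" for n :: nat
  have R: "1 \<le> R n" for n using C by (simp add: R_def)
  define A where "A n = {\<omega>\<in>space M. \<exists>y. R n < linf_norm y \<and> y \<in> gball (E \<omega>) UNIV n 0}" for n
  have A [measurable]: "A n \<in> events" for n
    unfolding A_def by measurable
  have bound: "emeasure M (A n) \<le> ennreal (C2 * (1 / (real n + 1) ^ 2))" for n
  proof -
    define e where "e = exp (C1 * (real n + 1) powr \<theta>)"
    have "A n = (\<Union>y\<in>{y. R n < linf_norm y}. {\<omega>\<in>space M. y \<in> gball (E \<omega>) UNIV n 0})"
      by (auto simp: A_def)
    then have "emeasure M (A n) \<le> (\<integral>\<^sup>+y. reach_prob n 0 y \<partial>count_space {y. R n < linf_norm y})"
      by (simp add: emeasure_UN_le_nn_integral)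
    also have "\<dots> \<le> (\<integral>\<^sup>+y. ennreal e * (if R n < linf_norm y then ennreal (linf_norm y powr - (real CARD('d) + \<alpha>)) else 0)
        \<partial>count_space {y :: int ^ 'd. R n < linf_norm y})"
    proof (rule nn_integral_mono)
      fix y assume "y \<in> space (count_space {y :: int ^ 'd. R n < linf_norm y})"
      then have y: "R n < linf_norm y" by simp
      then have "y \<noteq> 0" using R[of n] by auto
      then show "reach_prob n 0 y \<le>
        ennreal e * (if R n < linf_norm y then ennreal (linf_norm y powr - (real CARD('d) + \<alpha>)) else 0)"
        using C1(2)[of 0 y n] y by (simp add: e_def ennreal_mult)
    qed
    also have "\<dots> = (\<integral>\<^sup>+y. ennreal e * (if R n < linf_norm y then ennreal (linf_norm y powr - (real CARD('d) + \<alpha>)) else 0)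
        \<partial>count_space (UNIV :: (int ^ 'd) set))"
      by (rule nn_integral_count_space_eq) auto
    also have "\<dots> \<le> ennreal e * ennreal (C2 * R n powr - \<alpha>)"
      by (subst nn_integral_cmult) (auto intro!: mult_left_mono C2 R)
    also have "\<dots> = ennreal (C2 * (e * R n powr - \<alpha>))"
      using C2 by (simp add: e_def mult_ac flip: ennreal_mult)
    also have "\<dots> \<le> ennreal (C2 * (1 / (real n + 1) ^ 2))"
    proof (intro ennreal_leI mult_left_mono)
      define P where "P = (real n + 1) powr \<theta>"
      have "\<alpha> * C = C1 + 2 / \<theta>" using \<alpha> by (simp add: C_def)
      then have "(\<alpha> * C) * P = (C1 + 2 / \<theta>) * P" by (rule arg_cong)
      then have "\<alpha> * (C * P) = C1 * P + 2 * (P / \<theta>)"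
        by (simp only: mult.assoc distrib_right times_divide_eq_left times_divide_eq_right)
      then have "C1 * P + - \<alpha> * (C * P) = - (2 * (P / \<theta>))" by simp
      moreover have "e * R n powr - \<alpha> = exp (C1 * P + - \<alpha> * (C * P))"
        unfolding e_def R_def P_def[symmetric] exp_add powr_def[of "exp _"] by simp
      ultimately have "e * R n powr - \<alpha> = exp (- (2 * ((real n + 1) powr \<theta> / \<theta>)))"
        by (simp add: P_def)
      also have "\<dots> \<le> exp (- (2 * ln (real n + 1)))"
      proof -
        have "ln (real n + 1) \<le> (real n + 1) powr \<theta> / \<theta>"
          by (rule ln_le_powr_div) (use \<theta> in auto)
        then show ?thesis
          unfolding exp_le_cancel_iff by linarith
      qed
      also have "\<dots> = 1 / (real n + 1) ^ 2"
        unfolding exp_minus exp_double by (simp add: inverse_eq_divide)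
      finally show "e * R n powr - \<alpha> \<le> 1 / (real n + 1) ^ 2" .
    qed (use C2 in auto)
    finally show ?thesis .
  qed
  have "summable (\<lambda>n. measure M (A n))"
  proof (rule summable_comparison_test')
    have "summable (\<lambda>n. inverse (real (Suc n) ^ 2))"
      using inverse_power_summable[of 2, where 'a=real] by (subst summable_Suc_iff) auto
    then show "summable (\<lambda>n. C2 * (1 / (real n + 1) ^ 2))"
      by (intro summable_mult) (simp add: inverse_eq_divide add.commute)
    show "norm (measure M (A n)) \<le> C2 * (1 / (real n + 1) ^ 2)" for n
      using bound[of n] C2 by (simp add: emeasure_eq_measure)
  qed
  then have "AE \<omega> in M. \<forall>\<^sub>F n in sequentially. \<omega> \<in> space M - A n"
    by (intro borel_cantelli_AE1) (auto simp: emeasure_eq_measure)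
  then have "AE \<omega> in M. \<forall>\<^sub>F n in sequentially. gball (E \<omega>) UNIV n 0 \<subseteq> lattice_box (R n)"
    by eventually_elim (auto elim!: eventually_mono simp: A_def lattice_box_eq not_less)
  with C show thesis
    unfolding R_def by (rule that)
qed

end

section \<open>Random walks and activation\<close>

lemma walk_event [measurable]: "Measurable.pred (walk_law Q v) (\<lambda>w. w k = z)"
  by measurable

lemma walk_event_set [simp]: "{w. w k = z} \<in> sets (walk_law Q v)"
  using walk_event[where Q=Q and v=v and k=k and z=z] by (simp add: pred_def)

lemma emeasure_walk_law_0: "emeasure (walk_law Q v) {w. w 0 = z} = indicator {v} z"
  using emeasure_walk_law[of Q v 0 "\<lambda>_. z"] by (auto simp: indicator_def)

lemma nn_integral_walk_position:
  fixes Q :: "'v::countable \<Rightarrow> 'v pmf"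
  shows "(\<integral>\<^sup>+u. emeasure (walk_law Q v) {w. w k = u} \<partial>count_space UNIV) = 1"
proof -
  interpret prob_space "walk_law Q v" by (rule prob_space_walk_law)
  have "emeasure (walk_law Q v) (\<Union>u. {w \<in> space (walk_law Q v). w k = u}) =
      (\<integral>\<^sup>+u. emeasure (walk_law Q v) {w \<in> space (walk_law Q v). w k = u} \<partial>count_space UNIV)"
    by (rule emeasure_UN_countable) (auto simp: disjoint_family_on_def)
  moreover have "(\<Union>u. {w \<in> space (walk_law Q v). w k = u}) = space (walk_law Q v)"
    by auto
  ultimately show ?thesis
    using emeasure_space_1 by simp
qed

text \<open>The one-step Chapman-Kolmogorov equation, obtained from the cylinder formula by summing
  over all paths up to time \<open>k\<close>.\<close>

lemma emeasure_walk_law_Suc: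
  fixes Q :: "'v::countable \<Rightarrow> 'v pmf"
  shows "emeasure (walk_law Q v) {w. w (Suc k) = z} =
    (\<integral>\<^sup>+u. emeasure (walk_law Q v) {w. w k = u} * ennreal (pmf (Q u) z) \<partial>count_space UNIV)"
proof -
  define W where "W = walk_law Q v"
  have [simp]: "space W = UNIV" by (simp add: W_def)
  have [measurable]: "Measurable.pred W (\<lambda>w. w k = z)" for k z unfolding W_def by measurable
  have ev: "{w. w k = u \<and> w (Suc k) = z} \<in> sets W" for u
  proof -
    have "{w \<in> space W. w k = u \<and> w (Suc k) = z} \<in> sets W" by measurable
    then show ?thesis by simp
  qed
  \<comment> \<open>\<open>C p\<close> prescribes the path up to time \<open>k\<close>, and
    \<open>C' p\<close> also the next position \<open>z\<close>. Paths in \<open>I u\<close> are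
    extensional on \<open>{..k}\<close>, so each trajectory lies in the cylinder of just one of
    them.\<close>
  define C where "C p = {w. \<forall>i\<le>k. w i = p i}" for p :: "nat \<Rightarrow> 'v"
  define C' where "C' p = {w. \<forall>i\<le>Suc k. w i = (p(Suc k := z)) i}" for p :: "nat \<Rightarrow> 'v"
  define I where "I u = {p \<in> PiE {..k} (\<lambda>_. UNIV). p k = u}" for u :: 'v
  have I: "countable (I u)" for u
    by (rule countable_subset[OF _ countable_PiE[of "{..k}" "\<lambda>_. UNIV"]]) (auto simp: I_def)
  have sets: "C p \<in> sets W" "C' p \<in> sets W" for p
  proof -
    have "{w \<in> space W. \<forall>i\<in>{..n}. w i = q i} \<in> sets W" for n and q :: "nat \<Rightarrow> 'v" by measurable
    from this[of k p] this[of "Suc k" "p(Suc k := z)"] show "C p \<in> sets W" "C' p \<in> sets W"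
      by (simp_all add: C_def C'_def Ball_def)
  qed
  have C: "emeasure W (C' p) = emeasure W (C p) * ennreal (pmf (Q (p k)) z)" for p
  proof -
    have "(\<Prod>i<k. ennreal (pmf (Q ((p(Suc k := z)) i)) ((p(Suc k := z)) (Suc i)))) =
      (\<Prod>i<k. ennreal (pmf (Q (p i)) (p (Suc i))))"
      by (intro prod.cong) auto
    then show ?thesis
      unfolding C_def C'_def W_def emeasure_walk_law by simp
  qed
  have inI: "restrict w {..k} \<in> I (w k)" "w \<in> C (restrict w {..k})" for w
    by (auto simp: I_def C_def)
  have uniq: "p = p'" if "p \<in> I u" "p' \<in> I u'" "w \<in> C p" "w \<in> C p'" for p p' u u' w
  proof
    fix i show "p i = p' i"
      using that by (cases "i \<le> k") (auto simp: I_def C_def PiE_iff extensional_def)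
  qed
  have C'C: "C' p = C p \<inter> {w. w (Suc k) = z}" for p
    by (auto simp: C_def C'_def le_Suc_eq)
  have CI: "{w. w k = u} = (\<Union>p\<in>I u. C p)" for u
  proof safe
    fix w assume "u = w k"
    with inI[of w] show "w \<in> (\<Union>p\<in>I (w k). C p)" by blast
  next
    fix w p assume "p \<in> I u" "w \<in> C p"
    then show "w k = u" by (simp add: I_def C_def)
  qed
  then have CI': "{w. w k = u \<and> w (Suc k) = z} = (\<Union>p\<in>I u. C' p)" for u
    unfolding C'C by auto
  have step: "emeasure W {w. w k = u \<and> w (Suc k) = z} = emeasure W {w. w k = u} * ennreal (pmf (Q u) z)" for u
  proof -
    have "emeasure W {w. w k = u \<and> w (Suc k) = z} = (\<integral>\<^sup>+p. emeasure W (C' p) \<partial>count_space (I u))"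
      unfolding CI'
    proof (rule emeasure_UN_countable[OF sets(2) I])
      show "disjoint_family_on C' (I u)"
        using uniq[of _ u _ u] unfolding disjoint_family_on_def C'C by blast
    qed
    also have "\<dots> = (\<integral>\<^sup>+p. emeasure W (C p) * ennreal (pmf (Q u) z) \<partial>count_space (I u))"
      by (intro nn_integral_cong) (auto simp: C I_def)
    also have "\<dots> = (\<integral>\<^sup>+p. emeasure W (C p) \<partial>count_space (I u)) * ennreal (pmf (Q u) z)"
      by (rule nn_integral_multc) auto
    also have "(\<integral>\<^sup>+p. emeasure W (C p) \<partial>count_space (I u)) = emeasure W {w. w k = u}"
      unfolding CI
    proof (rule emeasure_UN_countable[OF sets(1) I, symmetric])
      show "disjoint_family_on C (I u)"
        using uniq[of _ u _ u] unfolding disjoint_family_on_def by blast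
    qed
    finally show ?thesis .
  qed
  have "emeasure W (\<Union>u. {w \<in> space W. w k = u \<and> w (Suc k) = z}) =
      (\<integral>\<^sup>+u. emeasure W {w \<in> space W. w k = u \<and> w (Suc k) = z} \<partial>count_space UNIV)"
    by (rule emeasure_UN_countable) (use ev in \<open>auto simp: disjoint_family_on_def\<close>)
  moreover have "(\<Union>u. {w \<in> space W. w k = u \<and> w (Suc k) = z}) = {w. w (Suc k) = z}"
    by auto
  ultimately show ?thesis
    using step by (simp add: W_def)
qed

lemma nn_integral_symmetric_kernel:
  assumes "symmetric_kernel Q"
  shows "(\<integral>\<^sup>+u. ennreal (pmf (Q u) y) \<partial>count_space UNIV) = 1"
proof -
  have "pmf (Q u) y = pmf (Q y) u" for u
    using assms by (simp add: symmetric_kernel_def)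
  then show ?thesis by (simp add: nn_integral_pmf_eq_1)
qed

text \<open>Either the first \<open>k\<close> steps or the last step cover at least half of the
  distance. In the first case the induction hypothesis applies and the sum of
  \<open>pmf (Q u) y\<close> over \<open>u\<close> is 1 by symmetry; in the second the bound on
  \<open>Q\<close> applies and the law at time \<open>k\<close> has mass 1.\<close>

lemma walk_position_bound:
  fixes Q :: "int ^ 'd \<Rightarrow> (int ^ 'd) pmf" and s K :: real
  assumes "symmetric_kernel Q" and s: "0 \<le> s" and K: "0 \<le> K"
    and Q: "\<And>x y. x \<noteq> y \<Longrightarrow> pmf (Q x) y \<le> K * linf_norm (x - y) powr - s"
    and "x \<noteq> y"
  shows "emeasure (walk_law Q x) {w. w k = y} \<le> ennreal (K * (1 + 2 powr s) ^ k * k * linf_norm (x - y) powr - s)"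
  using \<open>x \<noteq> y\<close>
proof (induction k arbitrary: y)
  case 0
  then show ?case by (simp add: emeasure_walk_law_0)
next
  case (Suc k)
  define r where "r = linf_norm (x - y) / 2"
  have r: "0 < r" using linf_norm_ge_1[of "x - y"] Suc.prems by (simp add: r_def)
  define c where "c = K * (1 + 2 powr s) ^ k * k"
  have c: "0 \<le> c" using K by (simp add: c_def)
  define F where "F u = emeasure (walk_law Q x) {w. w k = u}" for u
  have "emeasure (walk_law Q x) {w. w (Suc k) = y} = (\<integral>\<^sup>+u. F u * ennreal (pmf (Q u) y) \<partial>count_space UNIV)"
    unfolding F_def by (rule emeasure_walk_law_Suc)
  also have "\<dots> \<le> (\<integral>\<^sup>+u. ennreal (c * r powr - s) * ennreal (pmf (Q u) y) + F u * ennreal (K * r powr - s) \<partial>count_space UNIV)"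
  proof (rule nn_integral_mono)
    fix u
    consider "r \<le> linf_norm (x - u)" | "r \<le> linf_norm (u - y)"
      using linf_norm_triangle[of "x - u" "u - y"] by (fastforce simp: r_def)
    then show "F u * ennreal (pmf (Q u) y) \<le> ennreal (c * r powr - s) * ennreal (pmf (Q u) y) + F u * ennreal (K * r powr - s)"
    proof cases
      case 1
      then have "x \<noteq> u" using r by auto
      from Suc.IH[OF this] have "F u \<le> ennreal (c * linf_norm (x - u) powr - s)"
        by (simp add: F_def c_def)
      also have "\<dots> \<le> ennreal (c * r powr - s)"
        using 1 r s c by (intro ennreal_leI mult_left_mono powr_mono2') auto
      finally have "F u * ennreal (pmf (Q u) y) \<le> ennreal (c * r powr - s) * ennreal (pmf (Q u) y)"
        by (intro mult_right_mono) auto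
      then show ?thesis by (simp add: add_increasing2)
    next
      case 2
      then have "u \<noteq> y" using r by auto
      from Q[OF this] have "pmf (Q u) y \<le> K * linf_norm (u - y) powr - s" .
      also have "\<dots> \<le> K * r powr - s"
        using 2 r s K by (intro mult_left_mono powr_mono2') auto
      finally have "F u * ennreal (pmf (Q u) y) \<le> F u * ennreal (K * r powr - s)"
        by (intro mult_left_mono ennreal_leI) auto
      then show ?thesis by (simp add: add_increasing)
    qed
  qed
  also have "\<dots> = ennreal (c * r powr - s) + ennreal (K * r powr - s)"
    using nn_integral_walk_position[of Q x k] nn_integral_symmetric_kernel[OF assms(1), of y]
    by (subst nn_integral_add) (simp_all add: nn_integral_cmult nn_integral_multc F_def)
  also have "\<dots> = ennreal ((c + K) * r powr - s)"
    using c K by (simp add: distrib_right)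
  also have "\<dots> \<le> ennreal (K * (1 + 2 powr s) ^ Suc k * Suc k * linf_norm (x - y) powr - s)"
  proof (rule ennreal_leI)
    have "r powr - s = 2 powr s * linf_norm (x - y) powr - s"
      using linf_norm_nonneg[of "x - y"] by (simp add: r_def powr_divide powr_minus field_simps)
    \<comment> \<open>Halving the distance costs \<open>2 powr s\<close> per step; the closed form
      is a crude solution of this recursion that vanishes at \<open>k = 0\<close>.\<close>
    moreover have "(c + K) * 2 powr s \<le> K * (1 + 2 powr s) ^ Suc k * Suc k"
    proof -
      have "1 \<le> (1 + 2 powr s) ^ k" by (simp add: one_le_power)
      then have "K * 1 \<le> K * (1 + 2 powr s) ^ k" using K by (intro mult_left_mono)
      then have "c + K \<le> K * (1 + 2 powr s) ^ k * Suc k"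
        by (simp add: c_def algebra_simps)
      then have "(c + K) * 2 powr s \<le> K * (1 + 2 powr s) ^ k * Suc k * (1 + 2 powr s)"
        using K by (intro mult_mono) auto
      then show ?thesis by (simp add: mult_ac)
    qed
    ultimately have "(c + K) * r powr - s \<le> (K * (1 + 2 powr s) ^ Suc k * Suc k) * linf_norm (x - y) powr - s"
      by (metis mult.assoc mult_right_mono powr_ge_zero)
    then show "(c + K) * r powr - s \<le> K * (1 + 2 powr s) ^ Suc k * Suc k * linf_norm (x - y) powr - s" .
  qed
  finally show ?case .
qed

section \<open>Activated sets inside graph balls\<close>

definition frog_edge :: "nat \<Rightarrow> ('v \<Rightarrow> nat) \<times> ('v \<times> nat \<Rightarrow> nat \<Rightarrow> 'v) \<Rightarrow> 'v \<Rightarrow> 'v \<Rightarrow> bool" where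
  "frog_edge l \<omega> v u \<longleftrightarrow> (\<exists>i<fst \<omega> v. \<exists>k\<le>l. snd \<omega> (v, i) k = u)"

text \<open>A nonempty set of extended naturals contains its infimum, so a finite hitting time is
  realized by a particle.\<close>

lemma hit_time_eq_enat:
  assumes "hit_time l N X v u = enat k"
  shows "k \<le> l" "\<exists>i<N v. X (v, i) k = u"
proof -
  define S where "S = {enat k |k. k \<le> l \<and> (\<exists>i<N v. X (v, i) k = u)}"
  have hit: "hit_time l N X v u = Inf S" by (simp only: hit_time_def S_def)
  have "S \<noteq> {}" using assms unfolding hit by (auto simp: Inf_enat_def)
  then have "Inf S \<in> S" by (meson all_not_in_conv wellorder_InfI)
  then show "k \<le> l" "\<exists>i<N v. X (v, i) k = u" using assms unfolding hit by (auto simp: S_def)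
qed

text \<open>A step of positive hitting time costs at least one unit and follows one graph edge. A
  step of hitting time 0 does not move, because trajectories begin at their own vertex.\<close>

lemma frog_path_in_gball:
  assumes start: "\<And>v i. X (v, i) 0 = v"
    and "(\<Sum>i<m. hit_time l N X (p i) (p (Suc i))) \<le> enat n"
  shows "p m \<in> gball (frog_edge l (N, X)) UNIV n (p 0)"
  using assms(2)
proof (induction m arbitrary: n)
  case 0
  then show ?case by (simp add: center_in_gball)
next
  case (Suc m)
  obtain a where a: "(\<Sum>i<m. hit_time l N X (p i) (p (Suc i))) = enat a"
    using Suc.prems by (cases "\<Sum>i<m. hit_time l N X (p i) (p (Suc i))") auto
  obtain k where k: "hit_time l N X (p m) (p (Suc m)) = enat k"
    using Suc.prems a by (cases "hit_time l N X (p m) (p (Suc m))") auto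
  have ak: "a + k \<le> n" using Suc.prems a k by simp
  have pm: "p m \<in> gball (frog_edge l (N, X)) UNIV a (p 0)"
    by (rule Suc.IH) (simp add: a)
  show ?case
  proof (cases "k = 0")
    case True
    then have "p (Suc m) = p m" using hit_time_eq_enat[OF k] start by auto
    with pm ak True gball_mono[of a n "frog_edge l (N, X)" UNIV "p 0"] show ?thesis by auto
  next
    case False
    have "frog_edge l (N, X) (p m) (p (Suc m))"
      using hit_time_eq_enat[OF k] by (auto simp: frog_edge_def)
    with pm have "p (Suc m) \<in> gball (frog_edge l (N, X)) UNIV (Suc a) (p 0)" by auto
    with ak False gball_mono[of "Suc a" n "frog_edge l (N, X)" UNIV "p 0"] show ?thesis by auto
  qed
qed

text \<open>A finite activation time is attained by some path, and being an integer it is at most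
  the integer part of \<open>t\<close>.\<close>

lemma activated_subset_gball:
  assumes "\<And>v i. X (v, i) 0 = v"
  shows "activated l N X t \<subseteq> gball (frog_edge l (N, X)) UNIV (nat \<lfloor>t\<rfloor>) 0"
proof
  fix u assume "u \<in> activated l N X t"
  then have le: "ereal_of_enat (activation_time l N X 0 u) \<le> ereal t" by (simp add: activated_def)
  then obtain n where n: "activation_time l N X 0 u = enat n"
    by (cases "activation_time l N X 0 u") auto
  then have nt: "n \<le> nat \<lfloor>t\<rfloor>" using le by (simp add: le_nat_iff le_floor_iff)
  define S where "S = {\<Sum>i<m. hit_time l N X (p i) (p (Suc i)) |m p.
      p 0 = 0 \<and> p m = u \<and> (\<forall>i<m. hit_time l N X (p i) (p (Suc i)) < \<infinity>)}"
  have at: "activation_time l N X 0 u = Inf S" by (simp only: activation_time_def S_def)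
  have "S \<noteq> {}" using n unfolding at by (auto simp: Inf_enat_def)
  then have "Inf S \<in> S" by (meson all_not_in_conv wellorder_InfI)
  then obtain m p where p: "p 0 = 0" "p m = u" "(\<Sum>i<m. hit_time l N X (p i) (p (Suc i))) = enat n"
    using n unfolding at by (auto simp: S_def)
  with nt have "(\<Sum>i<m. hit_time l N X (p i) (p (Suc i))) \<le> enat (nat \<lfloor>t\<rfloor>)" by simp
  from frog_path_in_gball[OF assms this] p show "u \<in> gball (frog_edge l (N, X)) UNIV (nat \<lfloor>t\<rfloor>) 0" by simp
qed

section \<open>The graph of the frog model\<close>

lemma space_frog_law [simp]: "space (frog_law Q lam) = UNIV"
  by (auto simp: frog_law_def space_pair_measure space_PiM case_prod_beta')

text \<open>The joint law of finitely many particle counts and trajectories, from which both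
  independence and the edge estimates are read off.\<close>

lemma emeasure_frog_law_cylinder:
  assumes J: "finite J" "finite J'" and b: "\<And>p. p \<in> J' \<Longrightarrow> b p \<in> sets (walk_law Q (fst p))"
  shows "{\<omega>. (\<forall>v\<in>J. fst \<omega> v \<in> a v) \<and> (\<forall>p\<in>J'. snd \<omega> p \<in> b p)} \<in> sets (frog_law Q lam)"
    and "emeasure (frog_law Q lam) {\<omega>. (\<forall>v\<in>J. fst \<omega> v \<in> a v) \<and> (\<forall>p\<in>J'. snd \<omega> p \<in> b p)} =
      (\<Prod>v\<in>J. emeasure (measure_pmf (poisson_pmf lam)) (a v)) * (\<Prod>p\<in>J'. emeasure (walk_law Q (fst p)) (b p))"
proof -
  define M1 where "M1 = (\<Pi>\<^sub>M v\<in>(UNIV :: 'a set). measure_pmf (poisson_pmf lam))"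
  define M2 where "M2 = (\<Pi>\<^sub>M p\<in>(UNIV :: ('a \<times> nat) set). walk_law Q (fst p))"
  have frog: "frog_law Q lam = M1 \<Otimes>\<^sub>M M2"
    by (simp add: frog_law_def M1_def M2_def case_prod_beta')
  define A where "A = prod_emb UNIV (\<lambda>_. measure_pmf (poisson_pmf lam)) J (Pi\<^sub>E J a)"
  define B where "B = prod_emb UNIV (\<lambda>p. walk_law Q (fst p)) J' (Pi\<^sub>E J' b)"
  have A: "A = {f. \<forall>v\<in>J. f v \<in> a v}" and B: "B = {f. \<forall>p\<in>J'. f p \<in> b p}"
    by (auto simp: A_def B_def prod_emb_def space_PiM PiE_iff)
  have sets: "A \<in> sets M1" "B \<in> sets M2"
    unfolding A_def B_def M1_def M2_def using J b by (auto intro!: sets_PiM_I)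
  have eq: "{\<omega>. (\<forall>v\<in>J. fst \<omega> v \<in> a v) \<and> (\<forall>p\<in>J'. snd \<omega> p \<in> b p)} = A \<times> B"
    by (auto simp: A B)
  show "{\<omega>. (\<forall>v\<in>J. fst \<omega> v \<in> a v) \<and> (\<forall>p\<in>J'. snd \<omega> p \<in> b p)} \<in> sets (frog_law Q lam)"
    unfolding eq frog using sets by auto
  have "prob_space M2" unfolding M2_def by (intro prob_space_PiM prob_space_walk_law)
  then interpret M2: prob_space M2 .
  have "emeasure (frog_law Q lam) (A \<times> B) = emeasure M1 A * emeasure M2 B"
    unfolding frog by (rule M2.emeasure_pair_measure_Times[OF sets])
  also have "emeasure M1 A = (\<Prod>v\<in>J. emeasure (measure_pmf (poisson_pmf lam)) (a v))"
    unfolding M1_def A_def using J by (intro emeasure_PiM_emb) (auto simp: measure_pmf.prob_space_axioms)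
  also have "emeasure M2 B = (\<Prod>p\<in>J'. emeasure (walk_law Q (fst p)) (b p))"
    unfolding M2_def B_def using J b by (intro emeasure_PiM_emb) (auto simp: prob_space_walk_law)
  finally show "emeasure (frog_law Q lam) {\<omega>. (\<forall>v\<in>J. fst \<omega> v \<in> a v) \<and> (\<forall>p\<in>J'. snd \<omega> p \<in> b p)} =
      (\<Prod>v\<in>J. emeasure (measure_pmf (poisson_pmf lam)) (a v)) * (\<Prod>p\<in>J'. emeasure (walk_law Q (fst p)) (b p))"
    unfolding eq .
qed

text \<open>Counts and trajectories share one index type, \<open>Inl\<close> for the vertex of a
  count and \<open>Inr\<close> for a particle, so that they form a single independent
  family.\<close>

fun frog_coordinate :: "('v \<Rightarrow> 'v pmf) \<Rightarrow> 'v + 'v \<times> nat \<Rightarrow> (('v \<Rightarrow> nat) \<times> ('v \<times> nat \<Rightarrow> nat \<Rightarrow> 'v)) set set" where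
  "frog_coordinate Q (Inl v) = {{\<omega>. fst \<omega> v \<in> a} |a. True}"
| "frog_coordinate Q (Inr p) = {{\<omega>. snd \<omega> p \<in> b} |b. b \<in> sets (walk_law Q (fst p))}"

lemma Int_stable_frog_coordinate: "Int_stable (frog_coordinate Q j)"
proof (cases j)
  case (Inl v)
  show ?thesis unfolding Inl Int_stable_def
  proof safe
    fix a b assume "a \<in> frog_coordinate Q (Inl v)" "b \<in> frog_coordinate Q (Inl v)"
    then obtain a' b' where "a = {\<omega>. fst \<omega> v \<in> a'}" "b = {\<omega>. fst \<omega> v \<in> b'}" by auto
    then have "a \<inter> b = {\<omega>. fst \<omega> v \<in> a' \<inter> b'}" by auto
    then show "a \<inter> b \<in> frog_coordinate Q (Inl v)" by (simp only: frog_coordinate.simps) blast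
  qed
next
  case (Inr p)
  show ?thesis unfolding Inr Int_stable_def
  proof safe
    fix a b assume "a \<in> frog_coordinate Q (Inr p)" "b \<in> frog_coordinate Q (Inr p)"
    then obtain a' b' where ab: "a = {\<omega>. snd \<omega> p \<in> a'}" "b = {\<omega>. snd \<omega> p \<in> b'}"
      "a' \<in> sets (walk_law Q (fst p))" "b' \<in> sets (walk_law Q (fst p))" by auto
    then have "a \<inter> b = {\<omega>. snd \<omega> p \<in> a' \<inter> b'}" "a' \<inter> b' \<in> sets (walk_law Q (fst p))" by auto
    then show "a \<inter> b \<in> frog_coordinate Q (Inr p)" by (simp only: frog_coordinate.simps) blast
  qed
qed

lemma indep_frog_coordinates:
  "prob_space.indep_sets (frog_law Q lam) (frog_coordinate Q) UNIV"
proof -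
  interpret prob_space "frog_law Q lam" by (rule prob_space_frog_law)
  show ?thesis
  proof (rule indep_setsI)
    have "{\<omega>. fst \<omega> v \<in> a} \<in> events" for v a
      using emeasure_frog_law_cylinder(1)[of "{v}" "{}" undefined Q "\<lambda>_. a" lam] by simp
    moreover have "{\<omega>. snd \<omega> p \<in> b} \<in> events" if "b \<in> sets (walk_law Q (fst p))" for p b
      using emeasure_frog_law_cylinder(1)[of "{}" "{p}" "\<lambda>_. b" Q undefined lam] that by simp
    ultimately show "frog_coordinate Q j \<subseteq> events" for j
      by (cases j) auto
  next
    fix A and J :: "('a + 'a \<times> nat) set"
    assume J: "J \<noteq> {}" "finite J" and A: "\<forall>j\<in>J. A j \<in> frog_coordinate Q j"
    define J1 where "J1 = {v. Inl v \<in> J}"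
    define J2 where "J2 = {p. Inr p \<in> J}"
    have JJ: "J = Inl ` J1 \<union> Inr ` J2"
    proof (rule set_eqI)
      fix j show "j \<in> J \<longleftrightarrow> j \<in> Inl ` J1 \<union> Inr ` J2"
        by (cases j) (auto simp: J1_def J2_def)
    qed
    have fin: "finite J1" "finite J2"
      using J(2) unfolding J1_def J2_def by (auto intro!: finite_vimageI[unfolded vimage_def] simp: inj_def)
    have "\<forall>v\<in>J1. \<exists>a. A (Inl v) = {\<omega>. fst \<omega> v \<in> a}"
      using A by (fastforce simp: J1_def)
    then obtain a where a: "\<And>v. v \<in> J1 \<Longrightarrow> A (Inl v) = {\<omega>. fst \<omega> v \<in> a v}"
      by metis
    have "\<forall>p\<in>J2. \<exists>b. A (Inr p) = {\<omega>. snd \<omega> p \<in> b} \<and> b \<in> sets (walk_law Q (fst p))"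
      using A by (fastforce simp: J2_def)
    then obtain b where b: "\<And>p. p \<in> J2 \<Longrightarrow> A (Inr p) = {\<omega>. snd \<omega> p \<in> b p}"
      "\<And>p. p \<in> J2 \<Longrightarrow> b p \<in> sets (walk_law Q (fst p))"
      by metis
    have 1: "emeasure (frog_law Q lam) (A (Inl v)) = emeasure (measure_pmf (poisson_pmf lam)) (a v)" if "v \<in> J1" for v
      using emeasure_frog_law_cylinder(2)[of "{v}" "{}" undefined Q lam a] that a by simp
    have 2: "emeasure (frog_law Q lam) (A (Inr p)) = emeasure (walk_law Q (fst p)) (b p)" if "p \<in> J2" for p
      using emeasure_frog_law_cylinder(2)[of "{}" "{p}" b Q lam undefined] that b by simp
    have "(\<Inter>j\<in>J. A j) = {\<omega>. (\<forall>v\<in>J1. fst \<omega> v \<in> a v) \<and> (\<forall>p\<in>J2. snd \<omega> p \<in> b p)}"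
    proof -
      have "(\<Inter>j\<in>J. A j) = (\<Inter>v\<in>J1. A (Inl v)) \<inter> (\<Inter>p\<in>J2. A (Inr p))"
        unfolding JJ by auto
      also have "\<dots> = (\<Inter>v\<in>J1. {\<omega>. fst \<omega> v \<in> a v}) \<inter> (\<Inter>p\<in>J2. {\<omega>. snd \<omega> p \<in> b p})"
        using a b(1) by simp
      finally show ?thesis by auto
    qed
    then have "emeasure (frog_law Q lam) (\<Inter>j\<in>J. A j) =
       (\<Prod>v\<in>J1. emeasure (frog_law Q lam) (A (Inl v))) * (\<Prod>p\<in>J2. emeasure (frog_law Q lam) (A (Inr p)))"
      using emeasure_frog_law_cylinder(2)[OF fin b(2)] 1 2 by simp
    also have "\<dots> = (\<Prod>j\<in>J. emeasure (frog_law Q lam) (A j))"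
      unfolding JJ using fin by (subst prod.union_disjoint) (auto simp: prod.reindex)
    finally show "prob (\<Inter>j\<in>J. A j) = (\<Prod>j\<in>J. prob (A j))"
      by (simp add: emeasure_eq_measure prod_ennreal prod_nonneg)
  qed
qed

text \<open>The coordinates are grouped by starting vertex; the groups are disjoint, which makes the
  generated sigma-algebras independent.\<close>

definition frog_row :: "('v \<Rightarrow> 'v pmf) \<Rightarrow> 'v \<Rightarrow> (('v \<Rightarrow> nat) \<times> ('v \<times> nat \<Rightarrow> nat \<Rightarrow> 'v)) set set" where
  "frog_row Q v = sigma_sets UNIV (\<Union>j \<in> insert (Inl v) (range (\<lambda>i. Inr (v, i))). frog_coordinate Q j)"

lemma indep_frog_rows: "prob_space.indep_sets (frog_law Q lam) (frog_row Q) UNIV"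
proof -
  interpret prob_space "frog_law Q lam" by (rule prob_space_frog_law)
  have "indep_sets (\<lambda>v. sigma_sets (space (frog_law Q lam))
      (\<Union>j \<in> insert (Inl v) (range (\<lambda>i. Inr (v, i))). frog_coordinate Q j)) UNIV"
    by (rule indep_sets_collect_sigma[OF indep_sets_mono_index[OF _ indep_frog_coordinates]])
       (auto simp: disjoint_family_on_def Int_stable_frog_coordinate)
  then show ?thesis by (simp add: frog_row_def[abs_def])
qed

lemma frog_edge_in_row: "{\<omega>. frog_edge l \<omega> v u} \<in> frog_row Q v"
proof -
  interpret sigma_algebra UNIV "frog_row Q v"
    unfolding frog_row_def by (rule sigma_algebra_sigma_sets) simp
  have row: "a \<in> frog_row Q v" if "a \<in> frog_coordinate Q j" "j \<in> insert (Inl v) (range (\<lambda>i. Inr (v, i)))" for a j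
    unfolding frog_row_def using that by (intro sigma_sets.Basic UN_I)
  have 1: "{\<omega>. fst \<omega> v \<in> {i<..}} \<in> frog_row Q v" for i
  proof (rule row[of _ "Inl v"])
    show "{\<omega>. fst \<omega> v \<in> {i<..}} \<in> frog_coordinate Q (Inl v)"
      unfolding frog_coordinate.simps by blast
  qed simp
  have 2: "{\<omega>. snd \<omega> (v, i) \<in> {w. w k = u}} \<in> frog_row Q v" for i k
  proof (rule row[of _ "Inr (v, i)"])
    have "{w. w k = u} \<in> sets (walk_law Q (fst (v, i)))" by simp
    then show "{\<omega>. snd \<omega> (v, i) \<in> {w. w k = u}} \<in> frog_coordinate Q (Inr (v, i))"
      unfolding frog_coordinate.simps by blast
  qed simp
  have "{\<omega>. frog_edge l \<omega> v u} =
      (\<Union>i. \<Union>k\<in>{..l}. {\<omega>. fst \<omega> v \<in> {i<..}} \<inter> {\<omega>. snd \<omega> (v, i) \<in> {w. w k = u}})"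
    by (auto simp: frog_edge_def)
  also have "\<dots> \<in> frog_row Q v"
    using 1 2 by (intro countable_UN finite_UN image_subsetI Int) auto
  finally show ?thesis .
qed

interpretation frog: random_digraph "frog_law Q lam" "frog_edge l" "frog_row Q"
  for Q :: "'v::countable \<Rightarrow> 'v pmf" and lam l
proof -
  interpret prob_space "frog_law Q lam" by (rule prob_space_frog_law)
  show "random_digraph (frog_law Q lam) (frog_edge l) (frog_row Q)"
  proof
    fix v
    interpret row: sigma_algebra UNIV "frog_row Q v"
      unfolding frog_row_def by (rule sigma_algebra_sigma_sets) simp
    show "Int_stable (frog_row Q v)"
      by (auto simp: Int_stable_def)
  qed (use indep_frog_rows frog_edge_in_row in auto)
qed

section \<open>Edge probabilities of the frog graph\<close>

lemma poisson_mean_finite: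
  assumes "0 < lam"
  shows "(\<Sum>i. emeasure (measure_pmf (poisson_pmf lam)) {i<..}) < \<infinity>"
proof -
  \<comment> \<open>The sum of the tail probabilities is the mean.\<close>
  have "(\<Sum>i. emeasure (measure_pmf (poisson_pmf lam)) {i<..}) = (\<integral>\<^sup>+n. of_nat n \<partial>measure_pmf (poisson_pmf lam))"
    using nn_integral_nat_function[of "\<lambda>n. n" "measure_pmf (poisson_pmf lam)"] by (simp add: greaterThan_def)
  also have "\<dots> = (\<Sum>n. ennreal (pmf (poisson_pmf lam) n) * of_nat n)"
    by (simp add: nn_integral_measure_pmf nn_integral_count_space_nat)
  also have "\<dots> \<le> (\<Sum>n. ennreal ((2 * lam) ^ n / fact n * exp (- lam)))"
  proof (intro suminf_le)
    fix n
    \<comment> \<open>This crude bound compares the mean with the exponential series at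
      \<open>2 * lam\<close>.\<close>
    have "real n \<le> 2 ^ n" by (rule of_nat_less_two_power[THEN less_imp_le])
    then have "lam ^ n / fact n * exp (- lam) * n \<le> lam ^ n / fact n * exp (- lam) * 2 ^ n"
      using assms by (intro mult_left_mono) auto
    then show "ennreal (pmf (poisson_pmf lam) n) * of_nat n \<le> ennreal ((2 * lam) ^ n / fact n * exp (- lam))"
      using assms by (auto simp: ennreal_of_nat_eq_real_of_nat power_mult_distrib mult_ac simp flip: ennreal_mult intro!: ennreal_leI)
  qed auto
  also have "\<dots> = ennreal (\<Sum>n. (2 * lam) ^ n / fact n * exp (- lam))"
    using assms summable_exp[of "2 * lam"] by (intro suminf_ennreal2 summable_mult2) (auto simp: field_simps)
  also have "\<dots> < \<infinity>" by simp
  finally show ?thesis .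
qed

text \<open>Union bound over the particle number \<open>i\<close> and the time \<open>k\<close>.
  Particle \<open>i\<close> exists when the count exceeds \<open>i\<close>, independently of its
  trajectory, and the sum over \<open>i\<close> is the mean count.\<close>

lemma frog_edge_prob_le:
  fixes Q :: "'v::countable \<Rightarrow> 'v pmf"
  shows "emeasure (frog_law Q lam) {\<omega>. frog_edge l \<omega> v u} \<le>
    (\<Sum>i. emeasure (measure_pmf (poisson_pmf lam)) {i<..}) * (\<Sum>k\<le>l. emeasure (walk_law Q v) {w. w k = u})"
proof -
  define D :: "nat \<Rightarrow> nat \<Rightarrow> (('v \<Rightarrow> nat) \<times> ('v \<times> nat \<Rightarrow> nat \<Rightarrow> 'v)) set"
    where "D i k = {\<omega>. (\<forall>x\<in>{v}. fst \<omega> x \<in> {i<..}) \<and> (\<forall>p\<in>{(v, i)}. snd \<omega> p \<in> {w. w k = u})}" for i k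
  have D: "D i k \<in> sets (frog_law Q lam)"
    "emeasure (frog_law Q lam) (D i k) = emeasure (measure_pmf (poisson_pmf lam)) {i<..} * emeasure (walk_law Q v) {w. w k = u}" for i k
    unfolding D_def by (rule emeasure_frog_law_cylinder; simp) (subst emeasure_frog_law_cylinder; simp)
  have "{\<omega>. frog_edge l \<omega> v u} = (\<Union>i. \<Union>k\<in>{..l}. D i k)"
    by (auto simp: frog_edge_def D_def)
  also have "emeasure (frog_law Q lam) \<dots> \<le> (\<Sum>i. emeasure (frog_law Q lam) (\<Union>k\<in>{..l}. D i k))"
    using D(1) by (intro emeasure_subadditive_countably) auto
  also have "\<dots> \<le> (\<Sum>i. \<Sum>k\<le>l. emeasure (frog_law Q lam) (D i k))"
    using D(1) by (intro suminf_le emeasure_subadditive_finite) auto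
  also have "\<dots> = (\<Sum>i. emeasure (measure_pmf (poisson_pmf lam)) {i<..}) * (\<Sum>k\<le>l. emeasure (walk_law Q v) {w. w k = u})"
    by (simp add: D(2) sum_distrib_left[symmetric])
  finally show ?thesis .
qed

text \<open>The configuration space also contains trajectories with a wrong starting point; they are
  null for each of the countably many particles.\<close>

lemma AE_frog_start:
  fixes Q :: "'v::countable \<Rightarrow> 'v pmf"
  shows "AE \<omega> in frog_law Q lam. \<forall>v i. snd \<omega> (v, i) 0 = v"
proof -
  have "AE \<omega> in frog_law Q lam. snd \<omega> p 0 = fst p" for p
  proof -
    define S :: "(('v \<Rightarrow> nat) \<times> ('v \<times> nat \<Rightarrow> nat \<Rightarrow> 'v)) set"
      where "S = {\<omega>. (\<forall>x\<in>{}. fst \<omega> x \<in> UNIV) \<and> (\<forall>p\<in>{p}. snd \<omega> p \<in> {w :: nat \<Rightarrow> 'v. w 0 = fst p})}"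
    have S: "S \<in> sets (frog_law Q lam)" "emeasure (frog_law Q lam) S = 1"
      unfolding S_def
       apply (rule emeasure_frog_law_cylinder; simp)
      apply (subst emeasure_frog_law_cylinder; simp add: emeasure_walk_law_0)
      done
    have "AE \<omega> in frog_law Q lam. \<omega> \<in> S"
      using S by (intro frog.AE_prob_1) (simp add: frog.emeasure_eq_measure)
    then show ?thesis by eventually_elim (simp add: S_def)
  qed
  then have "AE \<omega> in frog_law Q lam. \<forall>p. snd \<omega> p 0 = fst p"
    by (subst AE_all_countable) simp
  then show ?thesis by eventually_elim simp
qed

text \<open>The constant is the mean count times the sum of the walk constants over the lifespan,
  raised to at least 1 to meet the normalization.\<close>

lemma long_range_frog:
  fixes Q :: "int ^ 'd \<Rightarrow> (int ^ 'd) pmf"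
  assumes "symmetric_kernel Q" "heavy_tailed_kernel Q \<alpha>" "0 < \<alpha>" "\<alpha> < real CARD('d)" "0 < lam"
  obtains K where "long_range_digraph (frog_law Q lam) (frog_edge l) (frog_row Q) \<alpha> K"
proof -
  define s where "s = real CARD('d) + \<alpha>"
  have s: "0 \<le> s" using assms by (simp add: s_def)
  obtain K0 where K0: "0 < K0" "\<And>x y. x \<noteq> y \<Longrightarrow> pmf (Q x) y \<le> K0 * linf_norm (x - y) powr - s"
    using assms(2) unfolding heavy_tailed_kernel_def s_def by blast
  obtain \<mu> where \<mu>: "0 \<le> \<mu>" "(\<Sum>i. emeasure (measure_pmf (poisson_pmf lam)) {i<..}) = ennreal \<mu>"
    using poisson_mean_finite[OF assms(5)] by (cases "\<Sum>i. emeasure (measure_pmf (poisson_pmf lam)) {i<..}") auto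
  define K1 where "K1 = (\<Sum>k\<le>l. K0 * (1 + 2 powr s) ^ k * real k)"
  have K1: "0 \<le> K1" using K0 by (auto simp: K1_def intro!: sum_nonneg)
  have edge: "emeasure (frog_law Q lam) {\<omega>. frog_edge l \<omega> u w} \<le> ennreal (max 1 (\<mu> * K1) * linf_norm (u - w) powr - s)"
    if "u \<noteq> w" for u w
  proof -
    have "emeasure (frog_law Q lam) {\<omega>. frog_edge l \<omega> u w} \<le> ennreal \<mu> * (\<Sum>k\<le>l. emeasure (walk_law Q u) {x. x k = w})"
      using frog_edge_prob_le[of Q lam l u w] by (simp add: \<mu>)
    also have "\<dots> \<le> ennreal \<mu> * (\<Sum>k\<le>l. ennreal (K0 * (1 + 2 powr s) ^ k * k * linf_norm (u - w) powr - s))"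
      using K0 s assms(1) that by (intro mult_left_mono sum_mono walk_position_bound) auto
    also have "\<dots> = ennreal (\<mu> * K1 * linf_norm (u - w) powr - s)"
      using \<mu>(1) K0 by (subst sum_ennreal) (auto simp: K1_def sum_distrib_right mult.assoc intro: ennreal_mult'[symmetric])
    also have "\<dots> \<le> ennreal (max 1 (\<mu> * K1) * linf_norm (u - w) powr - s)"
      by (intro ennreal_leI mult_right_mono) auto
    finally show ?thesis .
  qed
  have "long_range_digraph (frog_law Q lam) (frog_edge l) (frog_row Q) \<alpha> (max 1 (\<mu> * K1))"
    by (intro long_range_digraph.intro long_range_digraph_axioms.intro frog.random_digraph_axioms)
       (use edge assms in \<open>auto simp: s_def\<close>)
  then show thesis by (rule that)
qed

section \<open>From graph balls to the time scale of the activated sets\<close>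

theorem theorem2p4:
  fixes Q :: "int ^ 'd \<Rightarrow> (int ^ 'd) pmf" and \<alpha> \<Delta> lam :: real and l :: nat
  assumes "symmetric_kernel Q" and "translation_invariant_kernel Q" and "heavy_tailed_kernel Q \<alpha>"
    and "0 < \<alpha>" and "\<alpha> < real CARD('d)"
    and "\<Delta> > 0" and "inverse \<Delta> = log 2 (2 * real CARD('d) / (real CARD('d) + \<alpha>))"
    and "l \<ge> 1" and "lam > 0"
  shows "\<exists>c>0. AE (N, X) in frog_law Q lam.
    (\<forall>\<^sub>F L in at_top. activated l N X (c * (ln L) powr \<Delta>) \<subseteq> lattice_box L) \<and>
    ((\<lambda>L. real (card (activated l N X (c * (ln L) powr \<Delta>))) / L ^ CARD('d)) \<longlongrightarrow> 0) at_top"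
proof -
  obtain K where "long_range_digraph (frog_law Q lam) (frog_edge l) (frog_row Q) \<alpha> K"
    using long_range_frog assms by blast
  then interpret frog: long_range_digraph "frog_law Q lam" "frog_edge l" "frog_row Q" \<alpha> K .
  define \<theta> where "\<theta> = inverse \<Delta>"
  have \<theta>: "0 < \<theta>" "2 powr \<theta> = 2 * CARD('d) / (CARD('d) + \<alpha>)"
    using assms by (auto simp: \<theta>_def)
  obtain C where C: "C > 0" and AE_box: "AE \<omega> in frog_law Q lam. \<forall>\<^sub>F n in sequentially.
      gball (frog_edge l \<omega>) UNIV n 0 \<subseteq> lattice_box (exp (C * (real n + 1) powr \<theta>))"
    using frog.AE_gball_subset_box[OF \<theta>] by blast
  \<comment> \<open>Chosen so that \<open>(2 * c) powr \<theta> = 1 / (2 * C)\<close>, using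
    \<open>\<theta> * \<Delta> = 1\<close>. The factor 2 in front of \<open>c\<close> makes room for
    rounding, and the resulting \<open>1 / 2\<close> gives the box of radius
    \<open>sqrt L\<close>.\<close>
  define c where "c = (1 / (2 * C)) powr \<Delta> / 2"
  have c: "c > 0" using C by (simp add: c_def)
  have Cc: "C * (2 * c) powr \<theta> = 1 / 2"
    using C assms(6) by (simp add: c_def \<theta>_def powr_powr)
  have t_top: "filterlim (\<lambda>L. c * ln L powr \<Delta>) at_top at_top"
  proof -
    have "filterlim (\<lambda>x::real. x powr \<Delta>) at_top at_top"
    proof (rule filterlim_mono_eventually[OF _ order.refl order.refl])
      show "filterlim (\<lambda>x. exp (\<Delta> * ln x)) at_top at_top"
        using assms(6)
        by (intro filterlim_compose[OF exp_at_top] filterlim_tendsto_pos_mult_at_top[OF tendsto_const] ln_at_top)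
      show "\<forall>\<^sub>F x in at_top. exp (\<Delta> * ln x) = x powr \<Delta>"
        using eventually_gt_at_top[of 0] by eventually_elim (simp add: powr_def)
    qed
    from filterlim_compose[OF this ln_at_top] show ?thesis
      by (intro filterlim_tendsto_pos_mult_at_top[OF tendsto_const c])
  qed
  have box: "lattice_box (exp (C * (real (nat \<lfloor>c * ln L powr \<Delta>\<rfloor>) + 1) powr \<theta>)) \<subseteq> (lattice_box (sqrt L) :: (int ^ 'd) set)"
    if L: "1 < L" "1 \<le> c * ln L powr \<Delta>" for L
  proof -
    have "real (nat \<lfloor>c * ln L powr \<Delta>\<rfloor>) + 1 \<le> 2 * (c * ln L powr \<Delta>)"
      using L(2) by linarith
    then have "(real (nat \<lfloor>c * ln L powr \<Delta>\<rfloor>) + 1) powr \<theta> \<le> (2 * c * ln L powr \<Delta>) powr \<theta>"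
      using \<theta> by (intro powr_mono2) auto
    also have "\<dots> = (2 * c) powr \<theta> * ln L"
      using L c assms(6) by (simp add: powr_mult powr_powr \<theta>_def)
    finally have "C * (real (nat \<lfloor>c * ln L powr \<Delta>\<rfloor>) + 1) powr \<theta> \<le> C * ((2 * c) powr \<theta> * ln L)"
      using C by (intro mult_left_mono) auto
    also have "\<dots> = ln (sqrt L)"
      using L Cc by (simp add: ln_sqrt flip: mult.assoc)
    finally have "exp (C * (real (nat \<lfloor>c * ln L powr \<Delta>\<rfloor>) + 1) powr \<theta>) \<le> sqrt L"
      using L by (simp add: ln_ge_iff)
    then show ?thesis by (auto simp: lattice_box_eq)
  qed
  have "AE \<omega> in frog_law Q lam.
      (\<forall>\<^sub>F L in at_top. activated l (fst \<omega>) (snd \<omega>) (c * (ln L) powr \<Delta>) \<subseteq> lattice_box L) \<and>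
      ((\<lambda>L. real (card (activated l (fst \<omega>) (snd \<omega>) (c * (ln L) powr \<Delta>))) / L ^ CARD('d)) \<longlongrightarrow> 0) at_top"
    using AE_frog_start AE_box
  proof eventually_elim
    case (elim \<omega>)
    define A where "A L = activated l (fst \<omega>) (snd \<omega>) (c * (ln L) powr \<Delta>)" for L
    obtain n0 where n0: "\<And>n. n0 \<le> n \<Longrightarrow>
      gball (frog_edge l \<omega>) UNIV n 0 \<subseteq> lattice_box (exp (C * (real n + 1) powr \<theta>))"
      using elim(2) by (auto simp: eventually_sequentially)
    \<comment> \<open>The margin \<open>n0 + 1\<close> yields both \<open>n0 \<le> n\<close> after
      rounding down and the lower bound 1 that \<open>box\<close> asks for.\<close>
    have "\<forall>\<^sub>F L in at_top. real n0 + 1 \<le> c * ln L powr \<Delta>"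
      using t_top by (simp add: filterlim_at_top)
    with eventually_gt_at_top[of 1] have ev: "\<forall>\<^sub>F L in at_top. 1 < L \<and> A L \<subseteq> lattice_box (sqrt L)"
    proof eventually_elim
      case (elim L)
      define n where "n = nat \<lfloor>c * ln L powr \<Delta>\<rfloor>"
      have "n0 \<le> n" using elim(2) unfolding n_def by linarith
      have "A L \<subseteq> gball (frog_edge l \<omega>) UNIV n 0"
        unfolding A_def n_def using activated_subset_gball[of "snd \<omega>" l "fst \<omega>"] \<open>\<forall>v i. snd \<omega> (v, i) 0 = v\<close> by auto
      also have "\<dots> \<subseteq> lattice_box (exp (C * (real n + 1) powr \<theta>))" by (rule n0) fact
      also have "\<dots> \<subseteq> lattice_box (sqrt L)" unfolding n_def using elim by (intro box) auto
      finally show ?case using elim by simp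
    qed
    have "\<forall>\<^sub>F L in at_top. A L \<subseteq> lattice_box L"
      using ev
    proof eventually_elim
      case (elim L)
      then have "sqrt L \<le> L" by (intro real_le_lsqrt) (auto simp: power2_eq_square)
      with elim show ?case by (auto simp: lattice_box_eq)
    qed
    moreover have "((\<lambda>L. real (card (A L)) / L ^ CARD('d)) \<longlongrightarrow> 0) at_top"
    proof (rule tendsto_sandwich[OF _ _ tendsto_const])
      show "\<forall>\<^sub>F L in at_top. 0 \<le> real (card (A L)) / L ^ CARD('d)"
        using eventually_ge_at_top[of 0] by eventually_elim simp
      show "\<forall>\<^sub>F L in at_top. real (card (A L)) / L ^ CARD('d) \<le> (3 / sqrt L) ^ CARD('d)"
        using ev
      proof eventually_elim
        case (elim L)
        have "real (card (A L)) \<le> real (card (lattice_box (sqrt L) :: (int ^ 'd) set))"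
          using elim by (intro of_nat_mono card_mono finite_lattice_box) auto
        also have "\<dots> \<le> (2 * sqrt L + 1) ^ CARD('d)"
          using elim by (intro card_lattice_box) auto
        also have "\<dots> \<le> (3 * sqrt L) ^ CARD('d)"
          using elim by (intro power_mono) auto
        finally have "real (card (A L)) / L ^ CARD('d) \<le> (3 * sqrt L) ^ CARD('d) / L ^ CARD('d)"
          using elim by (intro divide_right_mono) auto
        also have "\<dots> = (3 * sqrt L / L) ^ CARD('d)" by (simp add: power_divide)
        also have "3 * sqrt L / L = 3 / sqrt L"
          using elim by (simp add: real_div_sqrt field_simps)
        finally show ?case .
      qed
      have "((\<lambda>L. 3 / sqrt L) \<longlongrightarrow> 0) at_top"
        by (intro tendsto_divide_0[OF tendsto_const] filterlim_at_top_imp_at_infinity sqrt_at_top)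
      \<comment> \<open>The limit \<open>0 ^ CARD('d)\<close> is 0 because the dimension is
        positive.\<close>
      from tendsto_power[OF this, of "CARD('d)"] show "((\<lambda>L. (3 / sqrt L) ^ CARD('d)) \<longlongrightarrow> 0) at_top"
        by (simp only: power_0_left zero_less_card_finite[THEN less_imp_neq, symmetric] if_False)
    qed
    ultimately show ?case by (simp add: A_def)
  qed
  then show ?thesis
    using c by (intro exI[of _ c]) (simp add: case_prod_beta')
qed

end
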